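(* Let $\ell\ge1$ be an integer and $\mu>0$. Let $H^{\mu,\ell}=W_\ell+\mu Z_\ell$ be the spherical harmonic of degree $\ell$ on $\mathbb{S}^2$ given in spherical coordinates by $\sin^{\ell}(\vartheta)\sin(\ell\varphi)+\mu P_\ell(\cos\vartheta)$. Then $H^{\mu,\ell}$ does not vanish at the north and south poles. If $\mu\notin\{\mu_i(\ell): 1\le i\le[\ell/2]\}$, then $H^{\mu,\ell}$ has no critical zero. In particular, for $0<\mu<\mu_c(\ell):=\inf_{1\le i\le[\ell/2]}\mu_i(\ell)$ (where $\mu_c(\ell)>0$), the function $H^{\mu,\ell}$ has no critical zero, its nodal set is a $1$-dimensional submanifold of the sphere, and hence consists of finitely many disjoint regular simple closed curves.
   Context: $\mathbb{S}^2\subset\mathbb{R}^3$ is the unit sphere, with north pole $p_+=(0,0,1)$ and south pole $p_-=(0,0,-1)$. Spherical coordinates are $E(\vartheta,\varphi)=(\sin\vartheta\cos\varphi,\sin\vartheta\sin\varphi,\cos\vartheta)$, $\vartheta\in[0,\pi]$, $\varphi\in\mathbb{R}/2\pi\mathbb{Z}$. The nodal set of a function on $\mathbb{S}^2$ is its zero set. A critical zero of $u$ is a point at which both $u$ and its differential $du$ vanish. $P_\ell(t)=\frac{1}{2^\ell\ell!}\frac{d^\ell}{dt^\ell}(t^2-1)^\ell$ is the Legendre polynomial. $Z_\ell$ is the spherical harmonic given in spherical coordinates by $P_\ell(\cos\vartheta)$, and $W_\ell$ is the restriction to $\mathbb{S}^2$ of $\mathrm{Im}\,(x+iy)^\ell$,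 i.e. $\sin^\ell(\vartheta)\sin(\ell\varphi)$. Let $0<\vartheta_1(\ell-1)<\cdots<\vartheta_{\ell-1}(\ell-1)<\pi$ be the zeros of $\vartheta\mapsto P_{\ell-1}(\cos\vartheta)$ in $(0,\pi)$, and for $1\le i\le\ell-1$ set $$\mu_i(\ell)=\frac{\sin^\ell(\vartheta_i(\ell-1))}{|P_\ell(\cos\vartheta_i(\ell-1))|}>0$$ (the denominators do not vanish since $P_\ell$ and $P_{\ell-1}$ have no common zero). $[\cdot]$ denotes the integer part; for $\ell=1$ the index set is empty and $\mu_c(1)=+\infty$. *)

theory Defs
  imports "HOL-Analysis.Analysis"
begin

abbreviation S2 :: "(real^3) set" where
  "S2 \<equiv> sphere 0 1"

definition north_pole :: "real^3" where
  "north_pole = vector [0, 0, 1]"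

definition south_pole :: "real^3" where
  "south_pole = vector [0, 0, -1]"

definition spherical_coords :: "real \<Rightarrow> real \<Rightarrow> real^3" where
  "spherical_coords \<theta> \<phi> = vector [sin \<theta> * cos \<phi>, sin \<theta> * sin \<phi>, cos \<theta>]"

definition legendre :: "nat \<Rightarrow> real poly" where
  "legendre l = smult (1 / (2 ^ l * fact l)) ((pderiv ^^ l) ([:-1, 0, 1:] ^ l))"

(* Functions on the sphere are represented by functions on the ambient space; only their values
   on S2 matter below. *)

definition Z_harm :: "nat \<Rightarrow> real^3 \<Rightarrow> real" where
  "Z_harm l p = poly (legendre l) (p $ 3)"

definition W_harm :: "nat \<Rightarrow> real^3 \<Rightarrow> real" where
  "W_harm l p = Im (Complex (p $ 1) (p $ 2) ^ l)"

definition H_harm :: "real \<Rightarrow> nat \<Rightarrow> real^3 \<Rightarrow> real" where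
  "H_harm \<mu> l p = W_harm l p + \<mu> * Z_harm l p"

lemma spherical_coords_image:
  "(\<lambda>(\<theta>, \<phi>). spherical_coords \<theta> \<phi>) ` ({0..pi} \<times> UNIV) = S2"
proof (intro equalityI subsetI)
  fix p assume "p \<in> (\<lambda>(\<theta>, \<phi>). spherical_coords \<theta> \<phi>) ` ({0..pi} \<times> (UNIV :: real set))"
  then obtain \<theta> \<phi> where p: "p = spherical_coords \<theta> \<phi>" by auto
  have "(sin \<theta> * cos \<phi>)\<^sup>2 + (sin \<theta> * sin \<phi>)\<^sup>2 + (cos \<theta>)\<^sup>2
      = (sin \<theta>)\<^sup>2 * ((cos \<phi>)\<^sup>2 + (sin \<phi>)\<^sup>2) + (cos \<theta>)\<^sup>2"
    by (simp only: power_mult_distrib distrib_left)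
  then have "(sin \<theta> * cos \<phi>)\<^sup>2 + (sin \<theta> * sin \<phi>)\<^sup>2 + (cos \<theta>)\<^sup>2 = 1"
    by (simp only: sin_cos_squared_add2 mult_1_right sin_cos_squared_add)
  then show "p \<in> S2"
    by (simp add: p spherical_coords_def norm_vec_def L2_set_def sum_3)
next
  fix p :: "real^3" assume "p \<in> S2"
  then have n: "(p $ 1)\<^sup>2 + (p $ 2)\<^sup>2 + (p $ 3)\<^sup>2 = 1"
    by (simp add: norm_vec_def L2_set_def sum_3)
  define \<theta> where "\<theta> = arccos (p $ 3)"
  have "(p $ 3)\<^sup>2 \<le> 1" using n by (smt (verit) zero_le_power2)
  then have b: "- 1 \<le> p $ 3" "p $ 3 \<le> 1"
    by (auto simp: abs_square_le_1 abs_le_iff)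
  then have t: "\<theta> \<in> {0..pi}" "cos \<theta> = p $ 3"
    by (auto simp: \<theta>_def arccos_lbound arccos_ubound)
  define z where "z = Complex (p $ 1) (p $ 2)"
  have "sin \<theta> = sqrt (1 - (p $ 3)\<^sup>2)" using b by (simp add: \<theta>_def sin_arccos)
  also have "1 - (p $ 3)\<^sup>2 = (p $ 1)\<^sup>2 + (p $ 2)\<^sup>2" using n by simp
  finally have s: "sin \<theta> = cmod z" by (simp add: z_def cmod_def)
  have "z = rcis (cmod z) (Arg z)" by (simp add: rcis_cmod_Arg)
  then have "Re z = sin \<theta> * cos (Arg z)" "Im z = sin \<theta> * sin (Arg z)"
    by (metis Re_rcis s, metis Im_rcis s)
  then have "p = spherical_coords \<theta> (Arg z)"
    using t by (simp add: spherical_coords_def vec_eq_iff forall_3 z_def)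
  with t show "p \<in> (\<lambda>(\<theta>, \<phi>). spherical_coords \<theta> \<phi>) ` ({0..pi} \<times> UNIV)"
    by (metis (mono_tags, lifting) SigmaI UNIV_I case_prod_conv image_eqI)
qed

lemma H_harm_spherical_coords:
  "H_harm \<mu> l (spherical_coords \<theta> \<phi>)
     = sin \<theta> ^ l * sin (real l * \<phi>) + \<mu> * poly (legendre l) (cos \<theta>)"
proof -
  have "Complex (sin \<theta> * cos \<phi>) (sin \<theta> * sin \<phi>) = rcis (sin \<theta>) \<phi>"
    by (simp add: complex_eq_iff)
  then show ?thesis
    by (simp add: H_harm_def W_harm_def Z_harm_def spherical_coords_def DeMoivre2)
qed

definition nodal_set :: "(real^3 \<Rightarrow> real) \<Rightarrow> (real^3) set" where
  "nodal_set u = {p \<in> S2. u p = 0}"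

(* A derivative D of u at p within S2 is unique only on the tangent plane, the orthogonal
   complement of p; its restriction to that plane is the differential of u on the sphere. *)

definition critical_zero :: "(real^3 \<Rightarrow> real) \<Rightarrow> real^3 \<Rightarrow> bool" where
  "critical_zero u p \<longleftrightarrow> p \<in> S2 \<and> u p = 0 \<and>
     (\<exists>D. (u has_derivative D) (at p within S2) \<and> (\<forall>v. v \<bullet> p = 0 \<longrightarrow> D v = 0))"

lemma H_harm_differentiable: "H_harm \<mu> l differentiable (at p within S2)"
proof -
  have W: "(\<lambda>p. Im (Complex (p $ 1) (p $ 2) ^ l)) differentiable (at p within S2)"
  proof -
    have "(\<lambda>p::real^3. Complex (p $ 1) (p $ 2))
        = (\<lambda>p. complex_of_real (p $ 1) + \<i> * complex_of_real (p $ 2))"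
      by (auto simp: complex_eq_iff)
    moreover have "bounded_linear
        (\<lambda>p::real^3. complex_of_real (p $ 1) + \<i> * complex_of_real (p $ 2))"
      by (intro bounded_linear_add bounded_linear_compose[OF bounded_linear_mult_right]
          bounded_linear_compose[OF bounded_linear_of_real] bounded_linear_vec_nth)
    ultimately have "(\<lambda>p::real^3. Complex (p $ 1) (p $ 2)) differentiable (at p within S2)"
      by (simp add: bounded_linear_imp_differentiable)
    then have "(\<lambda>p. Complex (p $ 1) (p $ 2) ^ l) differentiable (at p within S2)"
      by (rule differentiable_power)
    then show ?thesis
      unfolding differentiable_def using has_derivative_Im by blast
  qed
  have Z: "(\<lambda>p. poly (legendre l) (p $ 3)) differentiable (at p within S2)"
  proof -
    have "((\<lambda>p::real^3. p $ 3) has_derivative (\<lambda>p. p $ 3)) (at p within S2)"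
      by (rule bounded_linear_imp_has_derivative) (rule bounded_linear_vec_nth)
    from has_derivative_compose[OF this, of "poly (legendre l)"]
      poly_DERIV[of "legendre l" "p $ 3"]
    show ?thesis
      unfolding differentiable_def has_field_derivative_def by blast
  qed
  show ?thesis
    unfolding H_harm_def[abs_def] W_harm_def Z_harm_def
    by (intro differentiable_add differentiable_mult differentiable_const W Z)
qed

(* theta i n is the i-th zero, counted from 1 in increasing order; the set of zeros is finite
   because legendre n is not the zero polynomial. *)

definition theta :: "nat \<Rightarrow> nat \<Rightarrow> real" where
  "theta i n = sorted_list_of_set {\<theta> \<in> {0<..<pi}. poly (legendre n) (cos \<theta>) = 0} ! (i - 1)"

definition mu_crit :: "nat \<Rightarrow> nat \<Rightarrow> real" where
  "mu_crit i l = sin (theta i (l - 1)) ^ l / \<bar>poly (legendre l) (cos (theta i (l - 1)))\<bar>"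

(* Extended real, so that the empty infimum (l = 1) is infinite. *)

definition mu_c :: "nat \<Rightarrow> ereal" where
  "mu_c l = (INF i\<in>{1..l div 2}. ereal (mu_crit i l))"

definition smooth_curve_on :: "real set \<Rightarrow> (real \<Rightarrow> real^3) \<Rightarrow> bool" where
  "smooth_curve_on I \<gamma> \<longleftrightarrow>
     (\<forall>n. \<forall>t\<in>I. ((\<lambda>f s. vector_derivative f (at s)) ^^ n) \<gamma> differentiable (at t))"

definition regular_curve_on :: "real set \<Rightarrow> (real \<Rightarrow> real^3) \<Rightarrow> bool" where
  "regular_curve_on I \<gamma> \<longleftrightarrow>
     smooth_curve_on I \<gamma> \<and> (\<forall>t\<in>I. vector_derivative \<gamma> (at t) \<noteq> 0)"

(* Embedded C-infinity submanifolds of dimension 1, described by local parametrizations: each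
   point has a relatively open neighbourhood in N that is the homeomorphic image of an open
   interval under a smooth immersion. A curve with values in S2 is a smooth immersion into S2
   exactly when it is one into the ambient space. *)

definition one_dim_submanifold_of_S2 :: "(real^3) set \<Rightarrow> bool" where
  "one_dim_submanifold_of_S2 N \<longleftrightarrow> N \<subseteq> S2 \<and>
     (\<forall>p\<in>N. \<exists>U a b \<gamma> \<psi>. open U \<and> p \<in> U \<and> regular_curve_on {a<..<b} \<gamma> \<and>
        homeomorphism {a<..<b} (N \<inter> U) \<gamma> \<psi>)"

(* The curve is parametrized by the whole line with period 1, so that it is also regular at the
   closing point; simple_path and path_image only look at the unit interval. *)

definition regular_simple_closed_curve :: "(real^3) set \<Rightarrow> bool" where
  "regular_simple_closed_curve C \<longleftrightarrow>
     (\<exists>\<gamma>. regular_curve_on UNIV \<gamma> \<and> (\<forall>t. \<gamma> (t + 1) = \<gamma> t) \<and>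
        simple_path \<gamma> \<and> path_image \<gamma> = C)"

end

(* Away from the poles H vanishes exactly where sin (l phi) = - mu P_l(t) / (1 - t^2)^(l/2), t = cos theta,
   and the t-derivative of the right-hand side is - mu l P_(l-1)(t) / (1 - t^2)^(l/2+1).  Critical zeros
   therefore sit over the zeros of P_(l-1), and only for mu = mu_i.  If mu < mu_c, the right-hand side
   has modulus < 1 at all its critical points, so it has modulus <= 1 exactly on a band [-b, b], and
   (1 - t^2)^l - mu^2 P_l(t)^2 = (b^2 - t^2) R(t) with R > 0 on [-b, b].  Substituting t = b cos s
   uniformises the nodal set: cos (l phi) = b sin s sqrt(R(t)) / (1 - t^2)^(l/2) is then smooth in s and
   phi' = mu P_(l-1)(t) / ((1 - t^2) sqrt(R(t))).  When s increases by 2 pi, phi increases by 2 pi k / l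
   for some integer k, and the nodal curves correspond to the orbits of translation by k on Z/l. *)

theory Submission imports Defs begin

section \<open>Legendre polynomials\<close>

text \<open>The nodal curves have to be smooth to all orders and to close up globally. Explicit
  formulas on the whole line give both at once, whereas implicit functions would leave local arcs to
  be pieced together. The obstacle sits at the latitudes t = b and t = -b: up to sign and a smooth
  factor, cos (l phi) is sqrt(b^2 - t^2), so with t as parameter both smoothness and the choice of
  branch break down there. After the substitution b sin s takes the place of the root, and its
  change of sign is the change of branch. Positivity of R up to the ends of the band says that b and
  -b are simple zeros; this holds because neither P_l nor P_(l-1) vanishes there. The integer k
  exists because cos (l phi) and sin (l phi) are 2 pi-periodic in s.\<close>

lemma higher_pderiv_X_mult:
  "(pderiv ^^ n) ([:0, 1:] * q) = [:0, 1:] * (pderiv ^^ n) q + smult (of_nat n) ((pderiv ^^ (n - 1)) (q :: real poly))"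
proof (induction n)
  case (Suc n)
  have "(pderiv ^^ Suc n) ([:0, 1:] * q)
      = pderiv ([:0, 1:] * (pderiv ^^ n) q + smult (of_nat n) ((pderiv ^^ (n - 1)) q))"
    using Suc by simp
  also have "\<dots> = [:0, 1:] * (pderiv ^^ Suc n) q + (pderiv ^^ n) q
      + smult (of_nat n) (pderiv ((pderiv ^^ (n - 1)) q))"
    by (simp add: pderiv_add pderiv_mult pderiv_pCons pderiv_smult)
  also have "smult (of_nat n) (pderiv ((pderiv ^^ (n - 1)) q)) = smult (of_nat n) ((pderiv ^^ n) q)"
    by (cases n) auto
  finally show ?case by (simp add: algebra_simps smult_add_left)
qed simp

text \<open>The Legendre polynomial before normalisation; the factor 1/(2^n n!) is put back once the
  recurrences are known.\<close>

definition rodrigues :: "nat \<Rightarrow> real poly" where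
  "rodrigues n = (pderiv ^^ n) ([:-1, 0, 1:] ^ n)"

lemma pderiv_quadratic_power:
  "pderiv ([:-1, 0, 1:] ^ Suc n) = smult (2 * of_nat (Suc n)) ([:0, 1:] * [:-1, 0, 1 :: real:] ^ n)"
proof -
  have "pderiv [:-1, 0, 1 :: real:] = smult 2 [:0, 1:]" by (simp add: pderiv_pCons)
  then show ?thesis by (simp only: pderiv_power_Suc) (simp add: mult.commute)
qed

text \<open>With U = X^2 - 1, one of the n + 1 derivatives is spent on U^(n+1), giving 2(n+1) X U^n;
  the Leibniz rule for the factor X does the rest. The surplus term, the (n-1)-st derivative of U^n,
  is eliminated in the next two lemmas.\<close>

lemma rodrigues_Suc:
  "rodrigues (Suc n) = smult (2 * of_nat (Suc n))
     ([:0, 1:] * rodrigues n + smult (of_nat n) ((pderiv ^^ (n - 1)) ([:-1, 0, 1:] ^ n)))"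
  by (simp only: rodrigues_def funpow_Suc_right o_apply pderiv_quadratic_power
      higher_pderiv_smult higher_pderiv_X_mult)

lemma pderiv_rodrigues_Suc:
  "pderiv (rodrigues (Suc n)) = smult (2 * of_nat (Suc n))
     ([:0, 1:] * pderiv (rodrigues n) + smult (of_nat (Suc n)) (rodrigues n))"
proof -
  have "smult (of_nat n) (pderiv ((pderiv ^^ (n - 1)) ([:-1, 0, 1:] ^ n))) = smult (of_nat n) (rodrigues n)"
    by (cases n) (auto simp: rodrigues_def)
  then show ?thesis
    by (simp only: rodrigues_Suc pderiv_smult pderiv_add pderiv_mult)
       (simp add: pderiv_pCons algebra_simps smult_add_left)
qed

lemma rodrigues_Suc_pderiv:
  "poly (rodrigues (Suc n)) x =
     2 * ((x\<^sup>2 - 1) * poly (pderiv (rodrigues n)) x + real (Suc n) * x * poly (rodrigues n) x)"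
proof -
  let ?U = "[:-1, 0, 1 :: real:]" and ?B = "(pderiv ^^ (n - 1)) ([:-1, 0, 1:] ^ n)"
  \<comment> \<open>A second evaluation of the same derivative, from U^(n+1) = X X U^n - U^n. It
    contains the same surplus term \<open>?B\<close> as \<open>rodrigues_Suc\<close>, so the two
    equations together eliminate it.\<close>
  have "?U ^ Suc n = [:0, 1:] * ([:0, 1:] * ?U ^ n) - ?U ^ n"
    by (simp add: algebra_simps)
  also have "(pderiv ^^ Suc n) \<dots> =
      (pderiv ^^ Suc n) ([:0, 1:] * ([:0, 1:] * ?U ^ n)) - (pderiv ^^ Suc n) (?U ^ n)"
    using higher_pderiv_add[of "Suc n" "[:0, 1:] * ([:0, 1:] * ?U ^ n)" "smult (-1) (?U ^ n)"]
    by (simp only: higher_pderiv_smult) simp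
  also have "\<dots> = [:0, 1:] * ([:0, 1:] * pderiv (rodrigues n) + smult (of_nat (Suc n)) (rodrigues n))
      + smult (of_nat (Suc n)) ([:0, 1:] * rodrigues n + smult (of_nat n) ?B) - pderiv (rodrigues n)"
    by (simp only: higher_pderiv_X_mult rodrigues_def diff_Suc_1) simp
  finally have "rodrigues (Suc n) =
      [:0, 1:] * ([:0, 1:] * pderiv (rodrigues n) + smult (of_nat (Suc n)) (rodrigues n))
      + smult (of_nat (Suc n)) ([:0, 1:] * rodrigues n + smult (of_nat n) ?B) - pderiv (rodrigues n)"
    by (simp only: rodrigues_def)
  then have "poly (rodrigues (Suc n)) x =
      x * (x * poly (pderiv (rodrigues n)) x + real (Suc n) * poly (rodrigues n) x)
      + real (Suc n) * (x * poly (rodrigues n) x + real n * poly ?B x) - poly (pderiv (rodrigues n)) x"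
    by simp
  moreover have "poly (rodrigues (Suc n)) x = 2 * real (Suc n) * (x * poly (rodrigues n) x + real n * poly ?B x)"
    by (subst rodrigues_Suc) simp
  ultimately show ?thesis by (simp add: algebra_simps power2_eq_square)
qed

lemma legendre_rodrigues: "legendre n = smult (1 / (2 ^ n * fact n)) (rodrigues n)"
  by (simp add: legendre_def rodrigues_def)

lemma legendre_0 [simp]: "legendre 0 = 1"
  by (simp add: legendre_def)

lemma pderiv_legendre_Suc:
  "poly (pderiv (legendre (Suc n))) x =
     x * poly (pderiv (legendre n)) x + real (Suc n) * poly (legendre n) x"
  by (simp add: legendre_rodrigues pderiv_smult pderiv_rodrigues_Suc field_simps del: of_nat_Suc)

lemma legendre_Suc_pderiv:
  "real (Suc n) * poly (legendre (Suc n)) x =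
     (x\<^sup>2 - 1) * poly (pderiv (legendre n)) x + real (Suc n) * x * poly (legendre n) x"
  by (simp add: legendre_rodrigues pderiv_smult rodrigues_Suc_pderiv field_simps del: of_nat_Suc)

text \<open>Equivalently, P_l / (1 - x^2)^(l/2) has derivative l P_(l-1) / (1 - x^2)^(l/2 + 1) for
  |x| < 1. This is why P_(l-1) governs the critical zeros, the band and the speed of the
  phase.\<close>

lemma legendre_deriv:
  assumes "l \<ge> 1"
  shows "(1 - x\<^sup>2) * poly (pderiv (legendre l)) x =
     real l * (poly (legendre (l - 1)) x - x * poly (legendre l) x)"
proof -
  obtain n where l: "l = Suc n" using assms by (cases l) auto
  let ?a = "poly (pderiv (legendre n)) x" and ?p = "poly (legendre n) x" and ?q = "poly (legendre (Suc n)) x"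
  have "(1 - x\<^sup>2) * poly (pderiv (legendre (Suc n))) x
     = x * ((1 - x\<^sup>2) * ?a) + (1 - x\<^sup>2) * real (Suc n) * ?p"
    unfolding pderiv_legendre_Suc by (simp only: algebra_simps)
  also have "(1 - x\<^sup>2) * ?a = real (Suc n) * x * ?p - real (Suc n) * ?q"
    using legendre_Suc_pderiv[of n x] by (simp only: algebra_simps)
  also have "x * (real (Suc n) * x * ?p - real (Suc n) * ?q) + (1 - x\<^sup>2) * real (Suc n) * ?p
      = real (Suc n) * (?p - x * ?q)"
    by (simp add: algebra_simps power2_eq_square del: of_nat_Suc)
  finally show ?thesis by (simp add: l del: of_nat_Suc)
qed

lemma legendre_at_1 [simp]: "poly (legendre n) 1 = 1"
proof (induction n)
  case (Suc n)
  have "real (Suc n) * poly (legendre (Suc n)) 1 = real (Suc n) * 1"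
    by (subst legendre_Suc_pderiv) (use Suc in simp)
  then show ?case by (simp only: mult_cancel_left) simp
qed simp

lemma legendre_minus: "poly (legendre n) (- x) = (-1) ^ n * poly (legendre n) x"
proof (induction n arbitrary: x)
  case (Suc n)
  have eq: "poly (legendre n) (- y) = (-1) ^ n * poly (legendre n) y" for y by (rule Suc)
  \<comment> \<open>Differentiating the induction hypothesis in two ways gives the parity of the
    derivative of P_n, which enters the recurrence for P_(n+1).\<close>
  have "((\<lambda>y. poly (legendre n) (- y)) has_real_derivative - poly (pderiv (legendre n)) (- x)) (at x)"
    by (auto intro!: derivative_eq_intros poly_DERIV[THEN DERIV_chain2])
  moreover have "((\<lambda>y. poly (legendre n) (- y)) has_real_derivative (-1) ^ n * poly (pderiv (legendre n)) x) (at x)"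
    unfolding eq by (auto intro!: derivative_eq_intros)
  ultimately have d: "poly (pderiv (legendre n)) (- x) = - ((-1) ^ n * poly (pderiv (legendre n)) x)"
    using DERIV_unique by fastforce
  have "real (Suc n) * poly (legendre (Suc n)) (- x) =
      (-1) ^ Suc n * ((x\<^sup>2 - 1) * poly (pderiv (legendre n)) x + real (Suc n) * x * poly (legendre n) x)"
    unfolding legendre_Suc_pderiv d eq by (simp add: algebra_simps del: of_nat_Suc)
  also have "\<dots> = real (Suc n) * ((-1) ^ Suc n * poly (legendre (Suc n)) x)"
    unfolding legendre_Suc_pderiv[symmetric] by (simp only: mult.left_commute)
  finally have "real (Suc n) * poly (legendre (Suc n)) (- x)
      = real (Suc n) * ((-1) ^ Suc n * poly (legendre (Suc n)) x)" .
  then show ?case by (simp only: mult_cancel_left) simp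
qed simp

lemma legendre_minus_power2: "(poly (legendre n) (- x))\<^sup>2 = (poly (legendre n) x)\<^sup>2"
  by (simp add: legendre_minus power_mult_distrib flip: power_mult)

lemma legendre_minus_eq_0_iff: "poly (legendre n) (- x) = 0 \<longleftrightarrow> poly (legendre n) x = 0"
  by (simp add: legendre_minus)

lemma legendre_neq_0: "legendre n \<noteq> 0"
  using legendre_at_1[of n] by fastforce

text \<open>Descent: if P_(n+1) and P_(n+2) vanish at x, the recurrence for P_(n+2) kills the
  derivative of P_(n+1), because x^2 - 1 is not 0, and \<open>legendre_deriv\<close> then gives
  P_n(x) = 0. The descent ends at P_0 = 1.\<close>

lemma legendre_no_common_zero:
  assumes "x\<^sup>2 < 1" "poly (legendre n) x = 0"
  shows "poly (legendre (Suc n)) x \<noteq> 0"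
  using assms(2)
proof (induction n)
  case (Suc n)
  show ?case
  proof
    assume *: "poly (legendre (Suc (Suc n))) x = 0"
    have "poly (pderiv (legendre (Suc n))) x = 0"
      using legendre_Suc_pderiv[of "Suc n" x] * Suc.prems assms(1) by simp
    then have "poly (legendre n) x = 0"
      using legendre_deriv[of "Suc n" x] Suc.prems by simp
    then show False using Suc.IH Suc.prems by blast
  qed
qed simp

lemma degree_higher_pderiv: "degree ((pderiv ^^ k) (p :: real poly)) = degree p - k"
  by (induction k) (auto simp: degree_pderiv)

lemma degree_legendre: "degree (legendre n) = n"
  by (simp add: legendre_def degree_higher_pderiv degree_power_eq)

section \<open>Zeros of Legendre polynomials\<close>

lemma power_Suc_dvd_imp_power_dvd_pderiv:
  assumes "p ^ Suc m dvd (q :: real poly)"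
  shows "p ^ m dvd pderiv q"
proof -
  from assms obtain r where "q = p ^ Suc m * r" by (elim dvdE)
  then have "pderiv q = p ^ m * (p * pderiv r + r * smult (of_nat (Suc m)) (pderiv p))"
    by (simp only: pderiv_mult pderiv_power_Suc) (simp add: algebra_simps)
  then show ?thesis by simp
qed

lemma power_dvd_higher_pderiv:
  assumes "k \<le> n"
  shows "(p :: real poly) ^ (n - k) dvd (pderiv ^^ k) (p ^ n)"
  using assms
proof (induction k)
  case (Suc k)
  then have "p ^ Suc (n - Suc k) dvd (pderiv ^^ k) (p ^ n)" by (simp add: Suc_diff_Suc)
  then show ?case by (simp add: power_Suc_dvd_imp_power_dvd_pderiv del: power_Suc)
qed simp

text \<open>Rolle's theorem in each gap between neighbours of the sorted list. The gaps are
  disjoint, so the n points are distinct, and they lie strictly between a and b, which leaves room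
  to add both endpoints again before the next derivative.\<close>

lemma card_pderiv_roots:
  fixes p :: "real poly" and a b :: real
  assumes "finite A" "A \<subseteq> {a..b}" "\<And>x. x \<in> A \<Longrightarrow> poly p x = 0" "card A = Suc n"
  shows "\<exists>B. finite B \<and> B \<subseteq> {a<..<b} \<and> card B = n \<and> (\<forall>x\<in>B. poly (pderiv p) x = 0)"
proof -
  define xs where "xs = sorted_list_of_set A"
  have len: "length xs = Suc n" and st: "sorted_wrt (<) xs" and set: "set xs = A"
    using assms by (auto simp: xs_def)
  have mono: "xs ! i < xs ! j" if "i < j" "j \<le> n" for i j
    using sorted_wrt_nth_less[OF st that(1)] that(2) len by simp
  have mem: "xs ! i \<in> A" if "i \<le> n" for i using that len set by (metis le_imp_less_Suc nth_mem)
  have "\<exists>z. xs ! i < z \<and> z < xs ! Suc i \<and> poly (pderiv p) z = 0" if "i < n" for i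
  proof -
    have "\<exists>z>xs ! i. z < xs ! Suc i \<and> DERIV (poly p) z :> 0"
      by (rule Rolle)
        (use that mono[of i "Suc i"] mem assms(3) in \<open>auto intro!: continuous_intros poly_differentiable\<close>)
    then show ?thesis using poly_DERIV DERIV_unique by metis
  qed
  then obtain z where z: "\<And>i. i < n \<Longrightarrow> xs ! i < z i \<and> z i < xs ! Suc i \<and> poly (pderiv p) (z i) = 0"
    by metis
  have zmono: "z i < z j" if "i < j" "j < n" for i j
  proof -
    have "xs ! Suc i \<le> xs ! j" using that mono[of "Suc i" j] by (cases "Suc i = j") auto
    then show ?thesis using z[of i] z[of j] that by fastforce
  qed
  have "inj_on z {..<n}"
  proof (rule inj_onI)
    fix i j assume "i \<in> {..<n}" "j \<in> {..<n}" "z i = z j"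
    then show "i = j" using zmono[of i j] zmono[of j i] by (cases i j rule: linorder_cases) auto
  qed
  then have "card (z ` {..<n}) = n" by (simp add: card_image)
  moreover have "z ` {..<n} \<subseteq> {a<..<b}"
  proof (intro image_subsetI)
    fix i assume "i \<in> {..<n}"
    then have "xs ! i \<in> {a..b}" "xs ! Suc i \<in> {a..b}" "xs ! i < z i" "z i < xs ! Suc i"
      using mem[of i] mem[of "Suc i"] z[of i] assms(2) by auto
    then show "z i \<in> {a<..<b}" by auto
  qed
  ultimately show ?thesis using z by (intro exI[of _ "z ` {..<n}"]) auto
qed

lemma card_roots_higher_pderiv_quadratic:
  assumes "k \<le> n"
  shows "\<exists>B. finite B \<and> B \<subseteq> {-1<..<1} \<and> card B = k \<and>
    (\<forall>x\<in>B. poly ((pderiv ^^ k) ([:-1, 0, 1 :: real:] ^ n)) x = 0)"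
  using assms
proof (induction k)
  case 0
  then show ?case by auto
next
  case (Suc k)
  then obtain B where B: "finite B" "B \<subseteq> {-1<..<1}" "card B = k"
    "\<forall>x\<in>B. poly ((pderiv ^^ k) ([:-1, 0, 1 :: real:] ^ n)) x = 0" by auto
  let ?q = "(pderiv ^^ k) ([:-1, 0, 1 :: real:] ^ n)"
  \<comment> \<open>The k-th derivative keeps the factor (X^2 - 1)^(n-k) with n - k > 0, hence
    vanishes at -1 and 1. Together with the k zeros inside these are k + 2 points, and Rolle's
    theorem returns k + 1.\<close>
  have "[:-1, 0, 1 :: real:] dvd [:-1, 0, 1:] ^ (n - k)" using Suc.prems by (intro dvd_power) simp
  also have "\<dots> dvd ?q" using Suc.prems by (intro power_dvd_higher_pderiv) simp
  finally obtain r where "?q = [:-1, 0, 1:] * r" by (elim dvdE)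
  then have ends: "poly ?q (-1) = 0" "poly ?q 1 = 0" by (simp_all only: poly_mult) simp_all
  have "card (insert (-1) (insert 1 B)) = Suc (Suc k)" "insert (-1) (insert 1 B) \<subseteq> {-1..1}"
    using B(1-3) by (auto simp: subset_iff card_insert_if)
  moreover have "poly ?q x = 0" if "x \<in> insert (-1) (insert 1 B)" for x
    using that B(4) ends by blast
  ultimately have "\<exists>B. finite B \<and> B \<subseteq> {-1<..<1} \<and> card B = Suc k \<and> (\<forall>x\<in>B. poly (pderiv ?q) x = 0)"
    using B(1) by (intro card_pderiv_roots[of "insert (-1) (insert 1 B)"]) simp_all
  then show ?case by (simp only: funpow.simps o_apply)
qed

definition legendre_angles :: "nat \<Rightarrow> real set" where
  "legendre_angles n = {\<theta> \<in> {0<..<pi}. poly (legendre n) (cos \<theta>) = 0}"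

lemma inj_on_cos: "inj_on cos {0<..<pi}"
  by (rule inj_onI) (auto intro: cos_inj_pi)

lemma cos_legendre_angles: "cos ` legendre_angles n = {x \<in> {-1<..<1}. poly (legendre n) x = 0}"
proof (intro equalityI subsetI)
  fix x assume x: "x \<in> {x \<in> {-1<..<1}. poly (legendre n) x = 0}"
  then have "arccos x \<in> legendre_angles n" "cos (arccos x) = x"
    using arccos_lt_bounded[of x] by (auto simp: legendre_angles_def cos_arccos)
  then show "x \<in> cos ` legendre_angles n" by force
next
  fix x assume "x \<in> cos ` legendre_angles n"
  then obtain \<theta> where "x = cos \<theta>" "0 < \<theta>" "\<theta> < pi" "poly (legendre n) x = 0"
    by (auto simp: legendre_angles_def)
  then show "x \<in> {x \<in> {-1<..<1}. poly (legendre n) x = 0}"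
    using cos_monotone_0_pi[of 0 \<theta>] cos_monotone_0_pi[of \<theta> pi] by simp
qed

text \<open>Cosine is injective on (0, pi), so the zeros of P_n in (-1, 1) can be counted instead:
  the degree bounds their number from above, the iterated Rolle argument from below.\<close>

lemma finite_legendre_angles: "finite (legendre_angles n)"
  and card_legendre_angles: "card (legendre_angles n) = n"
proof -
  let ?R = "{x \<in> {-1<..<1}. poly (legendre n) x = 0}"
  have inj: "inj_on cos (legendre_angles n)"
    by (rule inj_on_subset[OF inj_on_cos]) (auto simp: legendre_angles_def)
  have fin: "finite {x. poly (legendre n) x = 0}"
    by (rule poly_roots_finite[OF legendre_neq_0])
  have finR: "finite ?R" by (rule finite_subset[OF _ fin]) auto
  then show "finite (legendre_angles n)"
    using inj cos_legendre_angles[of n] finite_imageD by metis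
  have "card ?R \<le> card {x. poly (legendre n) x = 0}" by (intro card_mono fin) auto
  also have "\<dots> \<le> degree (legendre n)" using card_poly_roots_bound[OF legendre_neq_0] .
  also have "\<dots> = n" by (rule degree_legendre)
  finally have "card ?R \<le> n" .
  moreover obtain B where B: "finite B" "B \<subseteq> {-1<..<1}" "card B = n"
    "\<forall>x\<in>B. poly (legendre n) x = 0"
    unfolding legendre_def using card_roots_higher_pderiv_quadratic[of n n] by auto
  then have "n \<le> card ?R"
    using card_mono[OF finR, of B] by (auto simp: subset_iff)
  ultimately show "card (legendre_angles n) = n"
    using card_image[OF inj] by (simp add: cos_legendre_angles)
qed

section \<open>Reflection symmetry of the zeros and the values \<open>mu_crit\<close>\<close>

lemma theta_eq: "theta i n = sorted_list_of_set (legendre_angles n) ! (i - 1)"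
  by (simp add: theta_def legendre_angles_def)

lemma theta_in:
  assumes "1 \<le> i" "i \<le> n"
  shows "theta i n \<in> legendre_angles n"
proof -
  have "i - 1 < length (sorted_list_of_set (legendre_angles n))"
    using assms by (simp add: card_legendre_angles)
  then show ?thesis
    unfolding theta_eq using nth_mem set_sorted_list_of_set[OF finite_legendre_angles] by blast
qed

lemma legendre_angles_reflect: "\<theta> \<in> legendre_angles n \<Longrightarrow> pi - \<theta> \<in> legendre_angles n"
  by (auto simp: legendre_angles_def legendre_minus_eq_0_iff)

text \<open>P_n is even or odd, so reflecting the sorted list of zeros in pi/2 and reversing it
  yields a sorted list of the same set, hence the same list.\<close>

lemma theta_reflect:
  assumes "1 \<le> i" "i \<le> n"
  shows "theta (Suc n - i) n = pi - theta i n"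
proof -
  let ?xs = "sorted_list_of_set (legendre_angles n)"
  have "rev (map (\<lambda>\<theta>. pi - \<theta>) ?xs) = ?xs"
  proof (rule sorted_distinct_set_unique)
    have "sorted_wrt (\<ge>) (map (\<lambda>\<theta>. pi - \<theta>) ?xs)"
      by (simp add: sorted_wrt_map)
    then show "sorted (rev (map (\<lambda>\<theta>. pi - \<theta>) ?xs))" by (simp add: sorted_wrt_rev)
    have "(\<lambda>\<theta>. pi - \<theta>) ` legendre_angles n = legendre_angles n"
    proof (intro equalityI subsetI)
      fix x assume "x \<in> legendre_angles n"
      then show "x \<in> (\<lambda>\<theta>. pi - \<theta>) ` legendre_angles n"
        by (intro image_eqI[of _ _ "pi - x"] legendre_angles_reflect) auto
    qed (auto dest: legendre_angles_reflect)
    then show "set (rev (map (\<lambda>\<theta>. pi - \<theta>) ?xs)) = set ?xs"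
      by (simp add: finite_legendre_angles)
  qed (auto simp: distinct_map inj_on_def)
  then have "?xs ! (n - i) = rev (map (\<lambda>\<theta>. pi - \<theta>) ?xs) ! (n - i)" by simp
  also have "\<dots> = pi - ?xs ! (i - 1)"
    using assms by (simp add: rev_nth card_legendre_angles)
  finally show ?thesis using assms by (simp add: theta_eq)
qed

text \<open>The index in \<open>mu_c\<close> stops at l div 2 although P_(l-1) has l - 1 zeros:
  reflection changes neither sin theta nor the modulus of P_l(cos theta), so a zero in the second
  half of the list gives the same value as its mirror image.\<close>

lemma legendre_angles_mu_crit:
  assumes "\<theta> \<in> legendre_angles (l - 1)"
  obtains i where "1 \<le> i" "i \<le> l div 2" "mu_crit i l = sin \<theta> ^ l / \<bar>poly (legendre l) (cos \<theta>)\<bar>"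
proof -
  have "\<theta> \<in> set (sorted_list_of_set (legendre_angles (l - 1)))"
    using assms by (simp add: finite_legendre_angles)
  then obtain k where k: "k < l - 1" "\<theta> = sorted_list_of_set (legendre_angles (l - 1)) ! k"
    by (auto simp: in_set_conv_nth card_legendre_angles)
  then have th: "\<theta> = theta (Suc k) (l - 1)" by (simp add: theta_eq)
  show ?thesis
  proof (cases "Suc k \<le> l div 2")
    case True
    then show ?thesis by (intro that[of "Suc k"]) (auto simp: mu_crit_def th)
  next
    case False
    \<comment> \<open>Position k counts from 0: the zero has index k + 1 and its mirror image among
      the l - 1 zeros has index l - (k + 1).\<close>
    have "theta (l - Suc k) (l - 1) = pi - \<theta>"
      using theta_reflect[of "Suc k" "l - 1"] k(1) th by simp
    then have "mu_crit (l - Suc k) l = sin \<theta> ^ l / \<bar>poly (legendre l) (cos \<theta>)\<bar>"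
      by (simp add: mu_crit_def legendre_minus abs_mult)
    then show ?thesis using False k(1) by (intro that[of "l - Suc k"]) auto
  qed
qed

lemma mu_crit_pos:
  assumes "1 \<le> i" "i \<le> l div 2"
  shows "mu_crit i l > 0"
proof -
  have th: "theta i (l - 1) \<in> legendre_angles (l - 1)" using assms by (intro theta_in) auto
  then have s: "sin (theta i (l - 1)) > 0" and z: "poly (legendre (l - 1)) (cos (theta i (l - 1))) = 0"
    by (auto simp: legendre_angles_def sin_gt_zero)
  have "(cos (theta i (l - 1)))\<^sup>2 < 1" using s by (simp add: cos_squared_eq)
  from legendre_no_common_zero[OF this z] have "poly (legendre l) (cos (theta i (l - 1))) \<noteq> 0"
    using assms by simp
  then show ?thesis using s by (simp add: mu_crit_def)
qed

lemma mu_c_pos: "mu_c l > 0"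
proof (cases "l div 2 = 0")
  case False
  \<comment> \<open>A finite nonempty infimum is a minimum, so strict positivity survives.\<close>
  then have "(INF i\<in>{1..l div 2}. ereal (mu_crit i l)) = Min ((\<lambda>i. ereal (mu_crit i l)) ` {1..l div 2})"
    by (intro Min_Inf[symmetric]) auto
  with False show ?thesis using mu_crit_pos by (auto simp: mu_c_def)
qed (simp add: mu_c_def top_ereal_def)

text \<open>The form in which the bound on mu is used: over a zero of P_(l-1), the value of sin (l
  phi) demanded by the nodal equation has modulus below 1. Squaring avoids the half-integral power
  of 1 - x^2.\<close>

lemma less_mu_c_legendre:
  assumes "ereal \<mu> < mu_c l" "\<mu> > 0" "x\<^sup>2 < 1" "poly (legendre (l - 1)) x = 0"
  shows "\<mu>\<^sup>2 * (poly (legendre l) x)\<^sup>2 < (1 - x\<^sup>2) ^ l"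
proof -
  have x: "\<bar>x\<bar> < 1" using assms(3) by (simp add: abs_square_less_1)
  define \<theta> where "\<theta> = arccos x"
  have th: "\<theta> \<in> legendre_angles (l - 1)" "cos \<theta> = x"
    using x assms arccos_lt_bounded[of x] by (auto simp: legendre_angles_def \<theta>_def)
  then obtain i where i: "1 \<le> i" "i \<le> l div 2" "mu_crit i l = sin \<theta> ^ l / \<bar>poly (legendre l) x\<bar>"
    by (metis legendre_angles_mu_crit)
  have "mu_c l \<le> ereal (mu_crit i l)" unfolding mu_c_def using i by (intro INF_lower) auto
  with assms(1) have lt: "\<mu> < mu_crit i l" by (metis ereal_less(1) less_le_trans less_ereal.simps(1))
  have "poly (legendre l) x \<noteq> 0"
    using mu_crit_pos[OF i(1,2)] i(3) by auto
  with lt i(3) have "\<mu> * \<bar>poly (legendre l) x\<bar> < sin \<theta> ^ l"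
    by (simp add: field_simps)
  then have "(\<mu> * \<bar>poly (legendre l) x\<bar>)\<^sup>2 < (sin \<theta> ^ l)\<^sup>2"
    using assms(2) by (intro power_strict_mono) auto
  moreover have "(sin \<theta> ^ l)\<^sup>2 = (1 - x\<^sup>2) ^ l"
    using th(2) by (metis power_mult mult.commute sin_squared_eq)
  ultimately show ?thesis by (simp add: power_mult_distrib)
qed

lemma less_mu_c_notin:
  assumes "ereal \<mu> < mu_c l"
  shows "\<mu> \<notin> {mu_crit i l |i. 1 \<le> i \<and> i \<le> l div 2}"
proof
  assume "\<mu> \<in> {mu_crit i l |i. 1 \<le> i \<and> i \<le> l div 2}"
  then obtain i where "\<mu> = mu_crit i l" "i \<in> {1..l div 2}" by auto
  then have "mu_c l \<le> ereal \<mu>" unfolding mu_c_def by (metis INF_lower)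
  with assms show False by simp
qed

section \<open>Critical zeros\<close>

lemma vector_3_eq_axis: "vector [x, y, z] = x *\<^sub>R axis 1 1 + y *\<^sub>R axis 2 1 + (z *\<^sub>R axis 3 1 :: real^3)"
  by (simp add: vec_eq_iff forall_3 axis_def)

lemma has_vector_derivative_vector_3:
  assumes "(f has_real_derivative f') F" "(g has_real_derivative g') F" "(h has_real_derivative h') F"
  shows "((\<lambda>s. vector [f s, g s, h s] :: real^3) has_vector_derivative vector [f', g', h']) F"
proof -
  have scaled: "((\<lambda>s. k s *\<^sub>R v) has_vector_derivative k' *\<^sub>R v) F"
    if "(k has_real_derivative k') F" for k :: "real \<Rightarrow> real" and k' and v :: "real^3"
    using that unfolding has_real_derivative_iff_has_vector_derivative
    by (rule bounded_linear.has_vector_derivative[OF bounded_linear_scaleR_left])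
  show ?thesis
    unfolding vector_3_eq_axis by (rule has_vector_derivative_add scaled assms)+
qed

lemma spherical_coords_in_S2: "spherical_coords \<theta> \<phi> \<in> S2"
proof -
  have "(sin \<theta> * cos \<phi>)\<^sup>2 + (sin \<theta> * sin \<phi>)\<^sup>2 + (cos \<theta>)\<^sup>2
      = (sin \<theta>)\<^sup>2 * ((cos \<phi>)\<^sup>2 + (sin \<phi>)\<^sup>2) + (cos \<theta>)\<^sup>2"
    by (simp only: power_mult_distrib distrib_left)
  then show ?thesis
    by (simp add: spherical_coords_def norm_vec_def L2_set_def sum_3)
qed

text \<open>Since c has constant length 1, its velocity at x is orthogonal to c x, and on such
  vectors the derivative of u vanishes. Critical zeros can thus be tested along curves on the
  sphere.\<close>

lemma critical_zero_curve:
  assumes "critical_zero u (c x)" "(c has_vector_derivative v) (at x)" "\<And>y. c y \<in> S2"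
  shows "((\<lambda>y. u (c y)) has_real_derivative 0) (at x)"
proof -
  obtain D where D: "(u has_derivative D) (at (c x) within S2)" "\<And>v. v \<bullet> c x = 0 \<Longrightarrow> D v = 0"
    using assms(1) unfolding critical_zero_def by blast
  have deriv: "((\<lambda>y. c y \<bullet> c y) has_derivative (\<lambda>h. c x \<bullet> (h *\<^sub>R v) + (h *\<^sub>R v) \<bullet> c x)) (at x)"
    using assms(2) unfolding has_vector_derivative_def by (intro has_derivative_inner)
  have "(\<lambda>y. c y \<bullet> c y) = (\<lambda>y. 1)"
    using assms(3) by (auto simp: dot_square_norm)
  then have "((\<lambda>y. c y \<bullet> c y) has_derivative (\<lambda>h. 0)) (at x)"
    by (simp only: has_derivative_const)
  from fun_cong[OF has_derivative_unique[OF deriv this], of 1]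
  have "v \<bullet> c x = 0" by (simp add: inner_commute)
  then have 0: "D (h *\<^sub>R v) = 0" for h using D(2)[of "h *\<^sub>R v"] by simp
  have "((\<lambda>y. u (c y)) has_derivative (\<lambda>h. D (h *\<^sub>R v))) (at x)"
  \<comment> \<open>The derivative of u is known only relative to the sphere, so the chain rule is
    applied within the range of c.\<close>
  proof (rule has_derivative_in_compose[where f = c and f' = "\<lambda>h. h *\<^sub>R v" and g' = D])
    show "(c has_derivative (\<lambda>h. h *\<^sub>R v)) (at x)" using assms(2) by (simp add: has_vector_derivative_def)
    show "(u has_derivative D) (at (c x) within range c)"
      using assms(3) by (intro has_derivative_subset[OF D(1)]) auto
  qed
  then show ?thesis by (simp add: 0 has_field_derivative_def lambda_zero)
qed

lemma H_harm_poles: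
  assumes "l \<ge> 1" "\<mu> > 0"
  shows "H_harm \<mu> l north_pole \<noteq> 0" "H_harm \<mu> l south_pole \<noteq> 0"
  using assms legendre_minus[of l 1]
  by (auto simp: H_harm_def W_harm_def Z_harm_def north_pole_def south_pole_def power_0_left
      simp flip: zero_complex.code)

text \<open>The parallel through p gives cos (l phi) = 0, the meridian gives P_(l-1)(cos theta) = 0.
  With sin (l phi) equal to 1 or -1, the equation H = 0 then reads mu = mu_i.\<close>

lemma critical_zero_H_harm:
  assumes l: "l \<ge> 1" and mu: "\<mu> > 0" and crit: "critical_zero (H_harm \<mu> l) p"
  shows "\<mu> \<in> {mu_crit i l |i. 1 \<le> i \<and> i \<le> l div 2}"
proof -
  from crit have "p \<in> S2" and H0: "H_harm \<mu> l p = 0" by (auto simp: critical_zero_def)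
  then obtain \<theta> \<phi> where p: "p = spherical_coords \<theta> \<phi>" and th: "0 \<le> \<theta>" "\<theta> \<le> pi"
    unfolding spherical_coords_image[symmetric] by auto
  let ?P = "poly (legendre l) (cos \<theta>)" and ?P' = "poly (pderiv (legendre l)) (cos \<theta>)"
  have H: "sin \<theta> ^ l * sin (real l * \<phi>) = - \<mu> * ?P"
    using H0 by (simp add: p H_harm_spherical_coords)
  \<comment> \<open>At a pole only mu P_l(1) or mu P_l(-1) would remain, and this is not 0.\<close>
  have "\<theta> \<noteq> 0" "\<theta> \<noteq> pi"
    using H l mu legendre_minus[of l 1] by (auto simp: power_0_left)
  with th have th: "0 < \<theta>" "\<theta> < pi" by auto
  then have s: "sin \<theta> > 0" by (simp add: sin_gt_zero)
  have "((\<lambda>y. H_harm \<mu> l (spherical_coords \<theta> y)) has_real_derivative 0) (at \<phi>)"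
  proof (rule critical_zero_curve)
    show "((\<lambda>y. spherical_coords \<theta> y) has_vector_derivative
        vector [sin \<theta> * - sin \<phi>, sin \<theta> * cos \<phi>, 0]) (at \<phi>)"
      unfolding spherical_coords_def
      by (intro has_vector_derivative_vector_3) (auto intro!: derivative_eq_intros)
  qed (use crit p spherical_coords_in_S2 in auto)
  moreover have "((\<lambda>y. H_harm \<mu> l (spherical_coords \<theta> y)) has_real_derivative
      sin \<theta> ^ l * (real l * cos (real l * \<phi>))) (at \<phi>)"
    unfolding H_harm_spherical_coords by (auto intro!: derivative_eq_intros)
  ultimately have "sin \<theta> ^ l * (real l * cos (real l * \<phi>)) = 0" using DERIV_unique by blast
  then have cos0: "cos (real l * \<phi>) = 0" using s l by simp
  have "((\<lambda>y. H_harm \<mu> l (spherical_coords y \<phi>)) has_real_derivative 0) (at \<theta>)"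
  proof (rule critical_zero_curve)
    show "((\<lambda>y. spherical_coords y \<phi>) has_vector_derivative
        vector [cos \<theta> * cos \<phi>, cos \<theta> * sin \<phi>, - sin \<theta>]) (at \<theta>)"
      unfolding spherical_coords_def
      by (intro has_vector_derivative_vector_3) (auto intro!: derivative_eq_intros)
  qed (use crit p spherical_coords_in_S2 in auto)
  moreover have "((\<lambda>y. H_harm \<mu> l (spherical_coords y \<phi>)) has_real_derivative
      real l * sin \<theta> ^ (l - 1) * cos \<theta> * sin (real l * \<phi>) + \<mu> * (?P' * - sin \<theta>)) (at \<theta>)"
    unfolding H_harm_spherical_coords
    by (auto intro!: derivative_eq_intros poly_DERIV[THEN DERIV_chain2])
  ultimately have "real l * sin \<theta> ^ (l - 1) * cos \<theta> * sin (real l * \<phi>) + \<mu> * (?P' * - sin \<theta>) = 0"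
    using DERIV_unique by blast
  \<comment> \<open>The extra factor sin theta completes the power to sin^l theta, for which the
    nodal equation can be substituted, and produces (1 - cos^2 theta) P_l', to which
    \<open>legendre_deriv\<close> applies. The terms in P_l then cancel.\<close>
  then have "sin \<theta> * (real l * sin \<theta> ^ (l - 1) * cos \<theta> * sin (real l * \<phi>) + \<mu> * (?P' * - sin \<theta>)) = 0"
    by (simp only: mult_zero_right)
  then have "real l * cos \<theta> * ((sin \<theta> * sin \<theta> ^ (l - 1)) * sin (real l * \<phi>)) - \<mu> * ((sin \<theta>)\<^sup>2 * ?P') = 0"
    by (simp add: algebra_simps power2_eq_square del: mult_eq_0_iff)
  moreover have "sin \<theta> * sin \<theta> ^ (l - 1) = sin \<theta> ^ l" using l by (simp add: power_eq_if)
  ultimately have "real l * cos \<theta> * (sin \<theta> ^ l * sin (real l * \<phi>)) - \<mu> * ((1 - (cos \<theta>)\<^sup>2) * ?P') = 0"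
    by (simp only: sin_squared_eq)
  then have "\<mu> * (real l * poly (legendre (l - 1)) (cos \<theta>)) = 0"
    unfolding H legendre_deriv[OF l] by (simp add: algebra_simps)
  then have "\<theta> \<in> legendre_angles (l - 1)" using mu l th by (simp add: legendre_angles_def)
  then obtain i where i: "1 \<le> i" "i \<le> l div 2" "mu_crit i l = sin \<theta> ^ l / \<bar>?P\<bar>"
    by (rule legendre_angles_mu_crit)
  have "(sin (real l * \<phi>))\<^sup>2 = 1" using cos0 by (simp add: sin_squared_eq)
  then have "\<bar>sin (real l * \<phi>)\<bar> = 1" by (metis abs_1 abs_minus power2_eq_1_iff)
  then have "sin \<theta> ^ l = \<bar>sin \<theta> ^ l * sin (real l * \<phi>)\<bar>" using s by (simp add: abs_mult)
  also have "\<dots> = \<mu> * \<bar>?P\<bar>" using mu by (simp only: H) (simp add: abs_mult)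
  finally have "\<mu> = mu_crit i l" using i(3) s mu by (cases "?P = 0") auto
  with i show ?thesis by blast
qed

section \<open>The band of latitudes that carries the nodal set\<close>

lemma DERIV_legendre_ratio:
  assumes "l \<ge> 1" "x\<^sup>2 < 1"
  shows "((\<lambda>t. (poly (legendre l) t)\<^sup>2 / (1 - t\<^sup>2) ^ l) has_real_derivative
    2 * real l * poly (legendre l) x * poly (legendre (l - 1)) x / (1 - x\<^sup>2) ^ Suc l) (at x)"
proof -
  let ?P = "poly (legendre l) x" and ?P' = "poly (pderiv (legendre l)) x" and ?w = "1 - x\<^sup>2"
  have w: "?w > 0" using assms by simp
  have "(2 * ?P * ?P' * ?w ^ l - ?P\<^sup>2 * (real l * ?w ^ (l - 1) * (- 2 * x))) * ?w ^ Suc l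
      = 2 * ?P * ((?w * ?P' + real l * x * ?P)) * (?w ^ l * ?w ^ l)"
  proof -
    \<comment> \<open>With v and u for the l-th and (l-1)-st powers of 1 - x^2, the relation v = (1
      - x^2) u turns the claim into a polynomial identity.\<close>
    have "(2 * ?P * ?P' * v - ?P\<^sup>2 * (real l * u * (- 2 * x))) * (?w * v)
      = 2 * ?P * ((?w * ?P' + real l * x * ?P)) * (v * v)" if "v = ?w * u" for u v
      unfolding that by algebra
    from this[of "?w ^ l" "?w ^ (l - 1)"] show ?thesis
      using assms(1) by (simp only: power_Suc power_minus_mult[symmetric] power_eq_if[of _ l]) simp
  qed
  also have "?w * ?P' + real l * x * ?P = real l * poly (legendre (l - 1)) x"
    using legendre_deriv[OF assms(1), of x] by (simp add: algebra_simps)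
  finally have "(2 * ?P * ?P' * ?w ^ l - ?P\<^sup>2 * (real l * ?w ^ (l - 1) * (- 2 * x))) / (?w ^ l * ?w ^ l)
      = 2 * real l * ?P * poly (legendre (l - 1)) x / ?w ^ Suc l"
    using w by (simp add: frac_eq_eq mult_ac)
  then show ?thesis
    using w by (auto intro!: derivative_eq_intros simp: mult_ac)
qed

lemma legendre_odd_at_0:
  assumes "odd n"
  shows "poly (legendre n) 0 = 0"
proof -
  have "poly (legendre n) (- 0) = - poly (legendre n) 0"
    by (simp only: legendre_minus) (simp add: assms)
  then show ?thesis by simp
qed

text \<open>What the analysis of the band hands over. \<open>outside\<close> keeps nodal points off
  the caps beyond b, \<open>factor\<close> and \<open>R_pos\<close> permit a smooth square root on
  the band, and \<open>legendre_b\<close> makes the curves move along the parallels at b and -b,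
  where their height is stationary.\<close>

locale nodal_curve =
  fixes l :: nat and \<mu> b :: real and R :: "real poly"
  assumes l_pos: "l \<ge> 1" and mu_pos: "\<mu> > 0" and b_pos: "0 < b" and b_less: "b < 1"
    and factor: "\<And>t. (1 - t\<^sup>2) ^ l - \<mu>\<^sup>2 * (poly (legendre l) t)\<^sup>2 = (b\<^sup>2 - t\<^sup>2) * poly R t"
    and R_pos: "\<And>t. \<bar>t\<bar> \<le> b \<Longrightarrow> poly R t > 0"
    and outside: "\<And>t. b < \<bar>t\<bar> \<Longrightarrow> \<bar>t\<bar> \<le> 1 \<Longrightarrow> (1 - t\<^sup>2) ^ l < \<mu>\<^sup>2 * (poly (legendre l) t)\<^sup>2"
    and legendre_b: "poly (legendre (l - 1)) b \<noteq> 0"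

lemma nodal_band:
  assumes l: "l \<ge> 1" and mu: "\<mu> > 0" "ereal \<mu> < mu_c l"
  obtains b R where "nodal_curve l \<mu> b R"
proof -
  let ?P = "poly (legendre l)" and ?P1 = "poly (legendre (l - 1))"
  define Q where "Q = [:1, 0, -1:] ^ l - smult (\<mu>\<^sup>2) (legendre l ^ 2)"
  have Q: "poly Q t = (1 - t\<^sup>2) ^ l - \<mu>\<^sup>2 * (?P t)\<^sup>2" for t
    by (simp add: Q_def power2_eq_square)
  have Q_even: "poly Q (- t) = poly Q t" for t by (simp add: Q legendre_minus_power2)
  have Q_pos: "poly Q t > 0" if "?P t = 0 \<or> ?P1 t = 0" "t\<^sup>2 < 1" for t
    using that less_mu_c_legendre[OF mu(2,1)] by (auto simp: Q)
  \<comment> \<open>One of l and l - 1 is odd, so 0 is a zero of P_l or of P_(l-1), where Q is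
    positive.\<close>
  have "?P 0 = 0 \<or> ?P1 0 = 0"
    using legendre_odd_at_0[of l] legendre_odd_at_0[of "l - 1"] l by (cases "even l") auto
  then have Q0: "poly Q 0 > 0" using Q_pos by simp
  have Q1: "poly Q 1 < 0" using mu l by (simp add: Q power_0_left)
  \<comment> \<open>b will be the last point of [0, 1] at which Q is nonnegative. Then Q < 0 beyond
    b by construction, and the work is to exclude zeros of Q inside (-b, b).\<close>
  define A where "A = {t \<in> {0..1}. poly Q t \<ge> 0}"
  have "closed {t. poly Q t \<ge> 0}"
    by (intro closed_Collect_le continuous_intros)
  moreover have A_eq: "A = {0..1} \<inter> {t. poly Q t \<ge> 0}" by (auto simp: A_def)
  ultimately have "compact A" by (simp add: compact_Int_closed)
  moreover have "A \<noteq> {}" using Q0 by (auto simp: A_def intro!: exI[of _ 0])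
  ultimately obtain b where b: "b \<in> A" "\<And>t. t \<in> A \<Longrightarrow> t \<le> b"
    using compact_attains_sup[of A] by blast
  have neg: "poly Q t < 0" if "b < t" "t \<le> 1" for t
    using b(2)[of t] b(1) that by (force simp: A_def)
  have b1: "b < 1" using b(1) Q1 by (cases "b = 1") (auto simp: A_def)
  have Qb: "poly Q b = 0"
  proof (rule ccontr)
    assume "poly Q b \<noteq> 0"
    then have "poly Q b > 0" using b(1) by (auto simp: A_def)
    then obtain x where "b < x" "x < 1" "poly Q x = 0" using poly_IVT_neg[OF b1 _ Q1] by blast
    then show False using neg[of x] by simp
  qed
  have b0: "0 < b" using Qb Q0 b(1) by (cases "b = 0") (auto simp: A_def)
  have sq: "t\<^sup>2 < 1" if "\<bar>t\<bar> \<le> b" for t using that b1 by (simp add: abs_square_less_1)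
  have P_neq: "?P t \<noteq> 0 \<and> ?P1 t \<noteq> 0" if "\<bar>t\<bar> \<le> b" "poly Q t \<le> 0" for t
    using Q_pos[OF _ sq[OF that(1)]] that(2) by force
  \<comment> \<open>F is the square of the value that the nodal equation demands of sin (l phi).
    Where F >= 1, neither P_l nor P_(l-1) vanishes, while the derivative of F is a nonzero multiple
    of P_l P_(l-1); so F has no critical point there.\<close>
  define F where "F = (\<lambda>t. \<mu>\<^sup>2 * ((?P t)\<^sup>2 / (1 - t\<^sup>2) ^ l))"
  have F_Q: "F t \<ge> 1 \<longleftrightarrow> poly Q t \<le> 0" "F t = 1 \<longleftrightarrow> poly Q t = 0" if "\<bar>t\<bar> \<le> b" for t
    using sq[OF that] by (auto simp: F_def Q field_simps)
  have F_deriv: "(F has_real_derivative \<mu>\<^sup>2 * (2 * real l * ?P t * ?P1 t / (1 - t\<^sup>2) ^ Suc l)) (at t)"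
    if "\<bar>t\<bar> \<le> b" for t
    unfolding F_def by (intro DERIV_cmult DERIV_legendre_ratio l sq that)
  have no_max: "\<exists>s. \<bar>s\<bar> \<le> b \<and> F s > F t" if t: "\<bar>t\<bar> < b" "poly Q t \<le> 0" for t
  proof (rule ccontr)
    assume "\<not> ?thesis"
    then have max: "\<And>s. \<bar>s\<bar> \<le> b \<Longrightarrow> F s \<le> F t" by force
    have "\<mu>\<^sup>2 * (2 * real l * ?P t * ?P1 t / (1 - t\<^sup>2) ^ Suc l) = 0"
    proof (rule DERIV_local_max[OF F_deriv])
      show "b - \<bar>t\<bar> > 0" "\<bar>t\<bar> \<le> b" using t by auto
      show "\<forall>y. \<bar>t - y\<bar> < b - \<bar>t\<bar> \<longrightarrow> F y \<le> F t" using max by auto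
    qed
    then show False using P_neq[of t] t mu l sq[of t] by auto
  qed
  \<comment> \<open>If Q(t) <= 0, the maximum of F on [-b, b] is at least F(t) >= 1. In the interior
    \<open>no_max\<close> forbids it; at an end F = 1, so t itself would be an interior maximum,
    which is forbidden too.\<close>
  have pos: "poly Q t > 0" if tb: "\<bar>t\<bar> < b" for t
  proof (rule ccontr)
    assume *: "\<not> ?thesis"
    have "continuous_on {-b..b} F"
      by (rule DERIV_continuous_on[OF DERIV_subset[OF F_deriv]]) auto
    then obtain m where m: "m \<in> {-b..b}" "\<And>s. s \<in> {-b..b} \<Longrightarrow> F s \<le> F m"
      using continuous_attains_sup[of "{-b..b}" F] b0 by auto
    have "t \<in> {-b..b}" using that by (auto simp: abs_if split: if_splits)
    have "F t \<ge> 1" using F_Q(1)[of t] * that by auto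
    have "\<bar>m\<bar> < b \<or> F m = 1"
      using m(1) F_Q(2)[of m] Qb Q_even[of b] by (cases "m = b \<or> m = - b") auto
    then show False
    proof
      assume "\<bar>m\<bar> < b"
      moreover have "F m \<ge> 1" using \<open>F t \<ge> 1\<close> m(2)[OF \<open>t \<in> {-b..b}\<close>] by simp
      ultimately obtain s where s: "\<bar>s\<bar> \<le> b" "F s > F m" using no_max[of m] F_Q(1)[of m] by auto
      then have "s \<in> {-b..b}" by (auto simp: abs_if split: if_splits)
      with s show False using m(2)[of s] by auto
    next
      assume "F m = 1"
      obtain s where s: "\<bar>s\<bar> \<le> b" "F s > F t" using no_max[OF tb] * by (auto simp: not_less)
      then have "s \<in> {-b..b}" by (auto simp: abs_if split: if_splits)
      with s show False using m(2)[of s] \<open>F t \<ge> 1\<close> \<open>F m = 1\<close> by auto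
    qed
  qed
  obtain R1 where R1: "Q = [:-b, 1:] * R1" using Qb by (auto simp: poly_eq_0_iff_dvd elim: dvdE)
  moreover have "poly Q (- b) = 0" using Qb Q_even by simp
  ultimately have "poly R1 (- b) = 0" using b0 by simp
  then obtain R2 where R2: "R1 = [:b, 1:] * R2" by (auto simp: poly_eq_0_iff_dvd elim: dvdE)
  \<comment> \<open>The sign is there because (t - b)(t + b) is the negative of b^2 - t^2.\<close>
  define R where "R = - R2"
  have QR: "poly Q t = (b\<^sup>2 - t\<^sup>2) * poly R t" for t
    by (simp add: R1 R2 R_def algebra_simps power2_eq_square)
  have R_pos: "poly R t > 0" if "\<bar>t\<bar> < b" for t
  proof -
    have "t\<^sup>2 < b\<^sup>2" using power_strict_mono[of "\<bar>t\<bar>" b 2] that by simp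
    then show ?thesis using pos[OF that] by (simp add: QR zero_less_mult_iff)
  qed
  \<comment> \<open>b and -b are simple zeros of Q: near them F = 1 - Q / (1 - t^2)^l, so a double
    zero would be a critical point of F with F = 1.\<close>
  have Q_deriv: "poly (pderiv Q) t \<noteq> 0" if "\<bar>t\<bar> = b" for t
  proof
    assume 0: "poly (pderiv Q) t = 0"
    have Qt: "poly Q t = 0" using that Qb Q_even[of b] by (auto simp: abs_if split: if_splits)
    have "(F has_real_derivative 0) (at t)"
    proof -
      have "((\<lambda>t. 1 - poly Q t / (1 - t\<^sup>2) ^ l) has_real_derivative 0) (at t)"
        using sq[of t] that 0 Qt by (auto intro!: derivative_eq_intros)
      moreover have "\<forall>\<^sub>F s in nhds t. 1 - poly Q s / (1 - s\<^sup>2) ^ l = F s"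
      proof -
        have "\<forall>\<^sub>F s in nhds t. s \<in> {-1<..<1}"
          using that b1 by (intro eventually_nhds_in_open) auto
        then show ?thesis
        proof eventually_elim
          case (elim s)
          then have "s\<^sup>2 < 1" by (simp add: abs_square_less_1 abs_if)
          then show ?case by (simp add: F_def Q field_simps)
        qed
      qed
      ultimately show ?thesis
        using DERIV_cong_ev[OF refl, of "\<lambda>s. 1 - poly Q s / (1 - s\<^sup>2) ^ l" F t 0 0] by simp
    qed
    moreover have "(F has_real_derivative \<mu>\<^sup>2 * (2 * real l * ?P t * ?P1 t / (1 - t\<^sup>2) ^ Suc l)) (at t)"
      using that by (intro F_deriv) simp
    ultimately have "\<mu>\<^sup>2 * (2 * real l * ?P t * ?P1 t / (1 - t\<^sup>2) ^ Suc l) = 0"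
      using DERIV_unique by blast
    then show False using P_neq[of t] that Qt mu l sq[of t] by auto
  qed
  have R_end: "poly R t \<noteq> 0" if "\<bar>t\<bar> = b" for t
  proof
    assume "poly R t = 0"
    moreover have "((\<lambda>t. (b\<^sup>2 - t\<^sup>2) * poly R t) has_real_derivative
        (b\<^sup>2 - t\<^sup>2) * poly (pderiv R) t + (- 2 * t) * poly R t) (at t)"
      by (auto intro!: derivative_eq_intros)
    moreover have "b\<^sup>2 = t\<^sup>2" by (metis power2_abs that)
    ultimately have "(poly Q has_real_derivative 0) (at t)" by (simp add: QR[abs_def])
    then show False using Q_deriv[OF that] poly_DERIV DERIV_unique by blast
  qed
  \<comment> \<open>R is positive inside (-b, b) and not 0 at the ends, so a negative end value
    would force a zero inside.\<close>
  have "poly R b > 0"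
  proof (rule ccontr)
    assume "\<not> poly R b > 0"
    then have "poly R b < 0" using R_end[of b] b0 by simp
    then obtain x where "0 < x" "x < b" "poly R x = 0" using poly_IVT_neg[of 0 b R] R_pos[of 0] b0 by auto
    then show False using R_pos[of x] by simp
  qed
  moreover have "poly R (- b) > 0"
  proof (rule ccontr)
    assume "\<not> poly R (- b) > 0"
    then have "poly R (- b) < 0" using R_end[of "- b"] b0 by simp
    then obtain x where "- b < x" "x < 0" "poly R x = 0" using poly_IVT_pos[of "- b" 0 R] R_pos[of 0] b0 by auto
    then show False using R_pos[of x] by simp
  qed
  ultimately have R_pos': "poly R t > 0" if "\<bar>t\<bar> \<le> b" for t
    using R_pos[of t] that by (cases "\<bar>t\<bar> = b") (auto simp: abs_if split: if_splits)
  show ?thesis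
  proof (rule that, unfold_locales)
    show "(1 - t\<^sup>2) ^ l < \<mu>\<^sup>2 * (?P t)\<^sup>2" if "b < \<bar>t\<bar>" "\<bar>t\<bar> \<le> 1" for t
      using neg[OF that] Q_even[of t] by (auto simp: Q abs_if split: if_splits)
    show "(1 - t\<^sup>2) ^ l - \<mu>\<^sup>2 * (?P t)\<^sup>2 = (b\<^sup>2 - t\<^sup>2) * poly R t" for t
      using QR[of t] Q[of t] by simp
    show "?P1 b \<noteq> 0" using P_neq[of b] Qb b0 by simp
  qed (fact l mu(1) b0 b1 R_pos')+
qed

section \<open>Smooth curves\<close>

text \<open>\<open>smooth_curve_on\<close> asks for every iterated derivative. Instead of computing
  these, the coordinates are placed in an algebra of functions closed under differentiation, for
  which it suffices that the generators have their derivatives in the algebra.\<close>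

inductive_set gen_algebra :: "(real \<Rightarrow> real) set \<Rightarrow> (real \<Rightarrow> real) set" for G where
  const: "(\<lambda>_. c) \<in> gen_algebra G"
| gen: "g \<in> G \<Longrightarrow> g \<in> gen_algebra G"
| add: "f \<in> gen_algebra G \<Longrightarrow> g \<in> gen_algebra G \<Longrightarrow> (\<lambda>s. f s + g s) \<in> gen_algebra G"
| mult: "f \<in> gen_algebra G \<Longrightarrow> g \<in> gen_algebra G \<Longrightarrow> (\<lambda>s. f s * g s) \<in> gen_algebra G"

lemma gen_algebra_minus: "f \<in> gen_algebra G \<Longrightarrow> (\<lambda>s. - f s) \<in> gen_algebra G"
  using gen_algebra.mult[OF gen_algebra.const[of "-1" G], of f] by simp

lemma gen_algebra_poly:
  assumes "f \<in> gen_algebra G"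
  shows "(\<lambda>s. poly p (f s)) \<in> gen_algebra G"
  by (induction p) (auto intro!: gen_algebra.const gen_algebra.add gen_algebra.mult assms)

definition deriv_closed :: "(real \<Rightarrow> real) set \<Rightarrow> bool" where
  "deriv_closed A \<longleftrightarrow> (\<forall>f\<in>A. \<exists>f'\<in>A. \<forall>s. (f has_real_derivative f' s) (at s))"

lemma deriv_closed_gen_algebra:
  assumes "\<And>g. g \<in> G \<Longrightarrow> \<exists>g'\<in>gen_algebra G. \<forall>s. (g has_real_derivative g' s) (at s)"
  shows "deriv_closed (gen_algebra G)"
  unfolding deriv_closed_def
proof
  fix f assume "f \<in> gen_algebra G"
  then show "\<exists>f'\<in>gen_algebra G. \<forall>s. (f has_real_derivative f' s) (at s)"
  proof induction
    case (const c)
    show ?case by (rule bexI[OF _ gen_algebra.const[of 0]]) simp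
  next
    case (gen g)
    then show ?case by (rule assms)
  next
    case (add f g)
    then obtain f' g' where "f' \<in> gen_algebra G" "g' \<in> gen_algebra G"
      "\<And>s. (f has_real_derivative f' s) (at s)" "\<And>s. (g has_real_derivative g' s) (at s)" by blast
    then show ?case
      by (intro bexI[of _ "\<lambda>s. f' s + g' s"] allI DERIV_add gen_algebra.add)
  next
    case (mult f g)
    then obtain f' g' where "f' \<in> gen_algebra G" "g' \<in> gen_algebra G"
      "\<And>s. (f has_real_derivative f' s) (at s)" "\<And>s. (g has_real_derivative g' s) (at s)" by blast
    then show ?case
      by (intro bexI[of _ "\<lambda>s. f' s * g s + g' s * f s"] allI DERIV_mult
          gen_algebra.add gen_algebra.mult mult.hyps)
  qed
qed

lemma smooth_curve_on_deriv_closed: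
  assumes A: "deriv_closed A" and "f \<in> A" "g \<in> A" "h \<in> A"
  shows "smooth_curve_on UNIV (\<lambda>s. vector [f s, g s, h s])"
proof -
  let ?D = "\<lambda>f s. vector_derivative f (at s)"
  have ex: "\<exists>f'\<in>A. \<exists>g'\<in>A. \<exists>h'\<in>A. \<forall>s.
      ((\<lambda>s. vector [f s, g s, h s] :: real^3) has_vector_derivative vector [f' s, g' s, h' s]) (at s)"
    if "f \<in> A" "g \<in> A" "h \<in> A" for f g h
  proof -
    obtain f' where "f' \<in> A" "\<And>s. (f has_real_derivative f' s) (at s)"
      using A \<open>f \<in> A\<close> unfolding deriv_closed_def by blast
    moreover obtain g' where "g' \<in> A" "\<And>s. (g has_real_derivative g' s) (at s)"
      using A \<open>g \<in> A\<close> unfolding deriv_closed_def by blast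
    moreover obtain h' where "h' \<in> A" "\<And>s. (h has_real_derivative h' s) (at s)"
      using A \<open>h \<in> A\<close> unfolding deriv_closed_def by blast
    ultimately show ?thesis
      by (intro bexI[of _ f'] bexI[of _ g'] bexI[of _ h'] allI has_vector_derivative_vector_3)
  qed
  \<comment> \<open>The induction carries only the shape: each iterated derivative again has its
    three coordinates in A.\<close>
  have form: "\<exists>f'\<in>A. \<exists>g'\<in>A. \<exists>h'\<in>A.
      (?D ^^ n) (\<lambda>s. vector [f s, g s, h s]) = (\<lambda>s. vector [f' s, g' s, h' s] :: real^3)" for n
  proof (induction n)
    case (Suc n)
    then obtain f1 g1 h1 where 1: "f1 \<in> A" "g1 \<in> A" "h1 \<in> A"
      "(?D ^^ n) (\<lambda>s. vector [f s, g s, h s]) = (\<lambda>s. vector [f1 s, g1 s, h1 s] :: real^3)" by blast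
    from ex[OF 1(1-3)] obtain f' g' h' where 2: "f' \<in> A" "g' \<in> A" "h' \<in> A" and
      "\<And>s. ((\<lambda>s. vector [f1 s, g1 s, h1 s] :: real^3) has_vector_derivative vector [f' s, g' s, h' s]) (at s)"
      by blast
    then have "?D (\<lambda>s. vector [f1 s, g1 s, h1 s]) = (\<lambda>s. vector [f' s, g' s, h' s] :: real^3)"
      by (intro ext vector_derivative_at)
    then have "(?D ^^ Suc n) (\<lambda>s. vector [f s, g s, h s]) = (\<lambda>s. vector [f' s, g' s, h' s] :: real^3)"
      by (simp only: funpow.simps o_apply 1(4))
    with 2 show ?case by blast
  qed (use assms in auto)
  have "(?D ^^ n) (\<lambda>s. vector [f s, g s, h s] :: real^3) differentiable (at t)" for n t
  proof -
    from form[of n] obtain f1 g1 h1 where 1: "f1 \<in> A" "g1 \<in> A" "h1 \<in> A"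
      "(?D ^^ n) (\<lambda>s. vector [f s, g s, h s]) = (\<lambda>s. vector [f1 s, g1 s, h1 s] :: real^3)" by blast
    from ex[OF 1(1-3)] show ?thesis
      unfolding 1(4) by (blast intro: differentiableI_vector)
  qed
  then show ?thesis unfolding smooth_curve_on_def by blast
qed

lemma regular_curve_on_subset: "regular_curve_on I \<gamma> \<Longrightarrow> J \<subseteq> I \<Longrightarrow> regular_curve_on J \<gamma>"
  unfolding regular_curve_on_def smooth_curve_on_def by blast

lemma regular_curve_on_continuous: "regular_curve_on UNIV \<gamma> \<Longrightarrow> continuous_on I \<gamma>"
proof -
  assume "regular_curve_on UNIV \<gamma>"
  then have "((\<lambda>f s. vector_derivative f (at s)) ^^ 0) \<gamma> differentiable (at t)" for t
    unfolding regular_curve_on_def smooth_curve_on_def by blast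
  then show ?thesis
    by (intro continuous_at_imp_continuous_on ballI differentiable_imp_continuous_within) simp
qed

lemma vector_derivative_scale:
  fixes \<gamma> :: "real \<Rightarrow> real^3"
  assumes "\<gamma> differentiable (at (c * t))"
  shows "((\<lambda>s. \<gamma> (c * s)) has_vector_derivative c *\<^sub>R vector_derivative \<gamma> (at (c * t))) (at t)"
proof -
  have "((\<lambda>s. c * s) has_real_derivative c) (at t)" by (auto intro!: derivative_eq_intros)
  moreover have "(\<gamma> has_vector_derivative vector_derivative \<gamma> (at (c * t))) (at (c * t))"
    using assms vector_derivative_works by blast
  ultimately show ?thesis
    using vector_diff_chain_at[of "\<lambda>s. c * s" c t \<gamma>]
    by (simp add: has_real_derivative_iff_has_vector_derivative o_def)
qed

text \<open>The n-th derivative merely picks up the factor c^n. This serves to bring curves of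
  period 2 pi d to period 1.\<close>

lemma regular_curve_on_scale:
  assumes "regular_curve_on UNIV \<gamma>" "c \<noteq> 0"
  shows "regular_curve_on UNIV (\<lambda>t. \<gamma> (c * t))"
proof -
  let ?D = "\<lambda>(f :: real \<Rightarrow> real^3) s. vector_derivative f (at s)"
  have diff: "(?D ^^ n) \<gamma> differentiable (at t)" for n t
    using assms(1) unfolding regular_curve_on_def smooth_curve_on_def by blast
  have deriv: "((\<lambda>s. c ^ n *\<^sub>R (?D ^^ n) \<gamma> (c * s)) has_vector_derivative
      c ^ Suc n *\<^sub>R (?D ^^ Suc n) \<gamma> (c * t)) (at t)" for n t
    using bounded_linear.has_vector_derivative[OF bounded_linear_scaleR_right
        vector_derivative_scale[OF diff[of n "c * t"]], of "c ^ n"]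
    by (simp add: mult.commute)
  have eq: "(?D ^^ n) (\<lambda>t. \<gamma> (c * t)) = (\<lambda>t. c ^ n *\<^sub>R (?D ^^ n) \<gamma> (c * t))" for n
  proof (induction n)
    case (Suc n)
    have "(?D ^^ Suc n) (\<lambda>t. \<gamma> (c * t)) = ?D (\<lambda>t. c ^ n *\<^sub>R (?D ^^ n) \<gamma> (c * t))"
      by (simp only: funpow.simps o_apply Suc)
    also have "\<dots> = (\<lambda>t. c ^ Suc n *\<^sub>R (?D ^^ Suc n) \<gamma> (c * t))"
      by (intro ext vector_derivative_at deriv)
    finally show ?case .
  qed simp
  have "smooth_curve_on UNIV (\<lambda>t. \<gamma> (c * t))"
    unfolding smooth_curve_on_def eq by (intro allI ballI differentiableI_vector[OF deriv])
  moreover have "vector_derivative (\<lambda>t. \<gamma> (c * t)) (at t) \<noteq> 0" for t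
  proof -
    have "\<gamma> differentiable (at (c * t))" using diff[of 0] by simp
    from vector_derivative_at[OF vector_derivative_scale[OF this]] show ?thesis
      using assms by (simp add: regular_curve_on_def)
  qed
  ultimately show ?thesis unfolding regular_curve_on_def by blast
qed

text \<open>The combinatorial model of the nodal set: the index j matters only modulo n, and
  advancing the parameter of \<open>C j\<close> by 2 pi has the effect of passing to
  \<open>C (j + k)\<close>. From this and regularity the whole component structure follows, with no
  further reference to H.\<close>

locale cyclic_curves =
  fixes C :: "int \<Rightarrow> real \<Rightarrow> real^3" and n k :: int
  assumes n_pos: "n > 0"
    and regular: "\<And>j. regular_curve_on UNIV (C j)"
    and C_eq_iff: "\<And>i j s t. C i s = C j t \<longleftrightarrow> (\<exists>m. t = s + 2 * pi * of_int m \<and> n dvd i - j - k * m)"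
begin

text \<open>The order of k in Z/n; 2 pi d turns out to be the least period of every
  \<open>C j\<close>.\<close>

definition d :: int where
  "d = int (LEAST q. q > 0 \<and> n dvd k * int q)"

lemma d_pos: "d > 0" and dvd_mult_d: "n dvd k * d"
proof -
  have "\<exists>q. q > 0 \<and> n dvd k * int q" using n_pos by (intro exI[of _ "nat n"]) simp
  from LeastI_ex[OF this] show "d > 0" "n dvd k * d" by (simp_all add: d_def)
qed

lemma dvd_iff: "n dvd k * m \<longleftrightarrow> d dvd m"
proof
  have min: "d \<le> q" if "q > 0" "n dvd k * q" for q
    using Least_le[of "\<lambda>q. q > 0 \<and> n dvd k * int q" "nat q"] that by (simp add: d_def)
  assume "n dvd k * m"
  \<comment> \<open>The remainder of m modulo d also annihilates k modulo n and is less than d,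
    hence 0 by minimality.\<close>
  moreover have "k * (m mod d) = k * m - k * d * (m div d)"
    unfolding minus_mult_div_eq_mod[symmetric] by (simp only: right_diff_distrib mult.assoc)
  moreover have "n dvd k * d * (m div d)" using dvd_mult_d by (rule dvd_mult2)
  ultimately have "n dvd k * (m mod d)" by (simp only: dvd_diff)
  then have "\<not> m mod d > 0" using min[of "m mod d"] pos_mod_bound[OF d_pos, of m] by linarith
  then have "m mod d = 0" using pos_mod_sign[OF d_pos, of m] by linarith
  then show "d dvd m" by (rule mod_0_imp_dvd)
next
  assume "d dvd m"
  then obtain q where "m = d * q" by (elim dvdE)
  then show "n dvd k * m" using dvd_mult2[OF dvd_mult_d, of q] by (simp only: mult.assoc)
qed

lemma C_same_iff: "C j s = C j t \<longleftrightarrow> (\<exists>q. t = s + 2 * pi * of_int (d * q))"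
proof -
  have "n dvd j - j - k * m \<longleftrightarrow> d dvd m" for m using dvd_iff[of m] by simp
  then show ?thesis unfolding C_eq_iff dvd_def by metis
qed

lemma C_period: "C j (s + 2 * pi * of_int (d * q)) = C j s"
  using C_same_iff by metis

lemma d_real: "real_of_int d \<ge> 1" using d_pos by linarith

lemma C_same_le:
  assumes "C j s = C j t" "s \<le> t" "t < s + 2 * pi * of_int d"
  shows "s = t"
proof -
  obtain q where q: "t = s + 2 * pi * of_int (d * q)" using assms(1) C_same_iff by blast
  let ?p = "2 * pi * real_of_int d"
  have p: "?p > 0" using d_pos by simp
  have t: "t = s + ?p * of_int q" using q by simp
  have "0 \<le> ?p * of_int q" "?p * of_int q < ?p * 1"
    using assms(2,3) unfolding t by linarith+
  then have "0 \<le> real_of_int q" "real_of_int q < 1"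
    using p zero_le_mult_iff[of ?p "of_int q"] mult_less_cancel_left_pos[OF p] by (linarith, blast)
  then have "q = 0" by linarith
  then show ?thesis using q by simp
qed

lemma shift_to_interval:
  obtains q where "a \<le> t + 2 * pi * of_int (d * q)" "t + 2 * pi * of_int (d * q) < a + 2 * pi * of_int d"
proof -
  define x where "x = (t - a) / (2 * pi * of_int d)"
  have p: "2 * pi * of_int d > 0" using d_real by simp
  have x: "t = a + 2 * pi * of_int d * x" using d_pos by (simp add: x_def)
  have "0 \<le> 2 * pi * of_int d * frac x" "2 * pi * of_int d * frac x < 2 * pi * of_int d * 1"
    using mult_left_mono[OF frac_ge_0[of x], of "2 * pi * of_int d"]
      mult_strict_left_mono[OF frac_lt_1[of x] p] p by auto
  then show ?thesis
    by (intro that[of "- \<lfloor>x\<rfloor>"]) (simp_all add: x frac_def algebra_simps)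
qed

lemma regular_simple_closed_curve_C: "regular_simple_closed_curve (range (C j))"
proof -
  define \<gamma> where "\<gamma> = (\<lambda>t. C j (2 * pi * of_int d * t))"
  have reg: "regular_curve_on UNIV \<gamma>"
    unfolding \<gamma>_def using d_pos by (intro regular_curve_on_scale regular) simp
  have per: "\<gamma> (t + of_int q) = \<gamma> t" for t q
    using C_period[of j "2 * pi * of_int d * t" q] by (simp add: \<gamma>_def algebra_simps)
  have "simple_path \<gamma>"
    unfolding simple_path_def loop_free_def path_def
  proof (intro conjI ballI impI)
    fix x y :: real assume xy: "x \<in> {0..1}" "y \<in> {0..1}" "\<gamma> x = \<gamma> y"
    then obtain q where "2 * pi * of_int d * y = 2 * pi * of_int d * x + 2 * pi * of_int (d * q)"
      unfolding \<gamma>_def C_same_iff by blast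
    then have "2 * pi * of_int d * y = 2 * pi * of_int d * (x + of_int q)" by (simp add: algebra_simps)
    \<comment> \<open>Parameters of the same point differ by an integer, and within [0, 1] a nonzero
      integer difference leaves only the two ends.\<close>
    then have y: "y = x + of_int q" using d_pos by simp
    with xy have "q \<le> 1" "q \<ge> -1" by auto
    then have "q = 0 \<or> q = 1 \<or> q = -1" by auto
    with y xy show "x = y \<or> x = 0 \<and> y = 1 \<or> x = 1 \<and> y = 0" by auto
  qed (rule regular_curve_on_continuous[OF reg])
  moreover have "path_image \<gamma> = range (C j)"
  proof (intro equalityI subsetI)
    fix p assume "p \<in> range (C j)"
    then obtain s where "p = C j s" by blast
    then have "p = \<gamma> (s / (2 * pi * of_int d))" using d_pos by (simp add: \<gamma>_def)
    also have "\<dots> = \<gamma> (frac (s / (2 * pi * of_int d)))"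
      using per[of "frac (s / (2 * pi * of_int d))" "\<lfloor>s / (2 * pi * of_int d)\<rfloor>"] by (simp add: frac_def)
    finally show "p \<in> path_image \<gamma>"
      unfolding path_image_def
      using frac_ge_0 frac_lt_1[THEN less_imp_le] by (auto intro!: imageI)
  qed (auto simp: path_image_def \<gamma>_def)
  ultimately show ?thesis
    unfolding regular_simple_closed_curve_def using reg per[of _ 1] by (intro exI[of _ \<gamma>]) auto
qed

lemma compact_range_C: "compact (range (C j))"
proof -
  obtain \<gamma> where "simple_path \<gamma>" "path_image \<gamma> = range (C j)"
    using regular_simple_closed_curve_C[of j] unfolding regular_simple_closed_curve_def by blast
  then show ?thesis using compact_simple_path_image by metis
qed

text \<open>One common point fixes the shift for the whole curve: the condition that n divides i - j
  - k m does not involve s, so \<open>C i\<close> is \<open>C j\<close> with the parameter advanced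
  by 2 pi m.\<close>

lemma range_C_subset: "range (C i) \<subseteq> range (C j)" if "range (C i) \<inter> range (C j) \<noteq> {}"
proof -
  from that obtain s t where "C i s = C j t" by auto
  then obtain m where "n dvd i - j - k * m" unfolding C_eq_iff by blast
  then have "C i s = C j (s + 2 * pi * of_int m)" for s unfolding C_eq_iff by blast
  then show ?thesis by auto
qed

lemma range_C_eq: "range (C i) = range (C j)" if "range (C i) \<inter> range (C j) \<noteq> {}"
  using range_C_subset[of i j] range_C_subset[of j i] that by blast

lemma range_C_mod: "range (C i) = range (C (i mod n))"
proof -
  have "C i 0 = C (i mod n) (0 + 2 * pi * of_int 0)"
    unfolding C_eq_iff by (intro exI[of _ 0]) (simp add: minus_mod_eq_mult_div)
  then show ?thesis by (intro range_C_eq) auto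
qed

lemma finite_ranges: "finite (range (\<lambda>j. range (C j)))"
proof -
  have "range (\<lambda>j. range (C j)) \<subseteq> (\<lambda>j. range (C j)) ` {0..<n}"
  proof (intro image_subsetI)
    fix j
    show "range (C j) \<in> (\<lambda>j. range (C j)) ` {0..<n}"
      using n_pos range_C_mod by (intro image_eqI[of _ _ "j mod n"]) simp_all
  qed
  then show ?thesis using finite_subset by blast
qed

lemma disjoint_ranges: "disjoint (range (\<lambda>j. range (C j)))"
  using range_C_eq unfolding pairwise_def disjnt_def by blast

text \<open>Around \<open>C j s0\<close> the union is cut down to the arc of parameters within 1 of
  s0: U omits the rest of the same curve and all other components. Both are closed, the latter
  because there are finitely many, each compact. The half-width 1 is safe since the period exceeds
  6.\<close>

lemma one_dim_submanifold_union:
  assumes "(\<Union>j. range (C j)) \<subseteq> S2"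
  shows "one_dim_submanifold_of_S2 (\<Union>j. range (C j))"
  unfolding one_dim_submanifold_of_S2_def
proof (intro conjI ballI assms)
  fix p assume "p \<in> (\<Union>j. range (C j))"
  then obtain j s0 where p: "p = C j s0" by blast
  let ?N = "\<Union>j. range (C j)" and ?p = "2 * pi * real_of_int d"
  have per: "C j (s + ?p) = C j s" for s using C_period[of j s 1] by simp
  have p6: "?p > 6" using mult_left_mono[OF d_real, of pi] pi_gt3 by linarith
  define others where "others = \<Union>{D \<in> range (\<lambda>j. range (C j)). D \<noteq> range (C j)}"
  define U where "U = - (others \<union> C j ` {s0 + 1..s0 + ?p - 1})"
  have "closed others" unfolding others_def
    using finite_ranges compact_range_C compact_imp_closed by (intro closed_Union) auto
  moreover have "closed (C j ` {s0 + 1..s0 + ?p - 1})"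
    by (intro compact_imp_closed compact_continuous_image regular_curve_on_continuous[OF regular]) simp
  ultimately have "open U" unfolding U_def by (intro open_Compl closed_Un)
  have others: "C j s \<notin> others" for s
    using range_C_eq[of _ j] unfolding others_def by blast
  have NU: "C j ` {s0 - 1<..<s0 + 1} = ?N \<inter> U"
  proof (intro equalityI subsetI)
    fix x assume "x \<in> C j ` {s0 - 1<..<s0 + 1}"
    then obtain t where t: "x = C j t" "s0 - 1 < t" "t < s0 + 1" by auto
    have "x \<notin> C j ` {s0 + 1..s0 + ?p - 1}"
    proof
      assume "x \<in> C j ` {s0 + 1..s0 + ?p - 1}"
      then obtain t' where t': "C j t = C j t'" "s0 + 1 \<le> t'" "t' \<le> s0 + ?p - 1" using t by auto
      then have "t = t'" using t by (intro C_same_le[OF t'(1)]) auto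
      then show False using t t' by simp
    qed
    then show "x \<in> ?N \<inter> U" using t others by (auto simp: U_def)
  next
    fix x assume x: "x \<in> ?N \<inter> U"
    then obtain i u where iu: "x = C i u" by blast
    have "x \<notin> others" using x by (simp add: U_def)
    then have "range (C i) = range (C j)" unfolding others_def iu by blast
    then obtain t where "x = C j t" using iu by blast
    moreover obtain q where "s0 - 1 \<le> t + 2 * pi * of_int (d * q)" "t + 2 * pi * of_int (d * q) < s0 - 1 + ?p"
      using shift_to_interval by blast
    ultimately obtain t where t: "x = C j t" "s0 - 1 \<le> t" "t < s0 - 1 + ?p" using C_period by metis
    have no: "x \<noteq> C j s" if "s0 + 1 \<le> s" "s \<le> s0 + ?p - 1" for s
      using x that by (auto simp: U_def)
    \<comment> \<open>The left end of the window is excluded because, one period later, it is the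
      right end of the omitted arc.\<close>
    have "t \<noteq> s0 - 1" using no[of "t + ?p"] per[of t] t p6 by auto
    moreover have "t < s0 + 1" using no[of t] t by force
    ultimately show "x \<in> C j ` {s0 - 1<..<s0 + 1}" using t by auto
  qed
  have "inj_on (C j) {s0 - 1..s0 + 1}"
  proof (rule inj_onI)
    fix s t assume "s \<in> {s0 - 1..s0 + 1}" "t \<in> {s0 - 1..s0 + 1}" "C j s = C j t"
    then show "s = t" using C_same_le[of j s t] C_same_le[of j t s] p6 by (cases "s \<le> t") auto
  qed
  \<comment> \<open>Compactness of the closed interval makes the inverse continuous; the
    homeomorphism is then restricted to the open interval.\<close>
  then obtain \<psi> where "homeomorphism {s0 - 1..s0 + 1} (C j ` {s0 - 1..s0 + 1}) (C j) \<psi>"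
    using homeomorphism_compact[of "{s0 - 1..s0 + 1}" "C j"] regular_curve_on_continuous[OF regular] by auto
  then have "homeomorphism {s0 - 1<..<s0 + 1} (?N \<inter> U) (C j) \<psi>"
    unfolding NU[symmetric] by (rule homeomorphism_of_subsets) auto
  moreover have "p \<in> U" using NU p by auto
  ultimately show "\<exists>U a b \<gamma> \<psi>. open U \<and> p \<in> U \<and> regular_curve_on {a<..<b} \<gamma> \<and>
      homeomorphism {a<..<b} (?N \<inter> U) \<gamma> \<psi>"
    using \<open>open U\<close> regular_curve_on_subset[OF regular] by blast
qed

end

section \<open>Uniformisation of the nodal set\<close>

context nodal_curve
begin

text \<open>z is the height and w the distance from the axis; X and Y are to be the cosine and sine
  of l times the longitude, and omega the derivative of the longitude. Y is forced by H = 0. In X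
  the signed b sin s stands for sqrt(b^2 - z^2), which keeps X smooth where z is b or -b.\<close>

definition z :: "real \<Rightarrow> real" where "z s = b * cos s"
definition w :: "real \<Rightarrow> real" where "w s = sqrt (1 - (z s)\<^sup>2)"
definition r :: "real \<Rightarrow> real" where "r s = sqrt (poly R (z s))"
definition omega :: "real \<Rightarrow> real" where "omega s = \<mu> * poly (legendre (l - 1)) (z s) / ((w s)\<^sup>2 * r s)"
definition X :: "real \<Rightarrow> real" where "X s = b * sin s * r s / w s ^ l"
definition Y :: "real \<Rightarrow> real" where "Y s = - \<mu> * poly (legendre l) (z s) / w s ^ l"

lemma abs_z: "\<bar>z s\<bar> \<le> b"
  using b_pos mult_left_mono[OF abs_cos_le_one[of s], of b] by (simp add: z_def abs_mult)

lemma z_sq: "(z s)\<^sup>2 < 1"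
  using abs_z[of s] b_less by (simp add: abs_square_less_1)

lemma w_pos: "w s > 0" and w_sq: "(w s)\<^sup>2 = 1 - (z s)\<^sup>2"
  using z_sq[of s] by (simp_all add: w_def)

lemma r_pos: "r s > 0" and r_sq: "(r s)\<^sup>2 = poly R (z s)"
  using R_pos[OF abs_z[of s]] by (simp_all add: r_def)

lemma z_sin_sq: "b\<^sup>2 - (z s)\<^sup>2 = (b * sin s)\<^sup>2"
  by (simp add: z_def power_mult_distrib sin_squared_eq algebra_simps)

text \<open>This is \<open>factor\<close> at z s, divided by (1 - z^2)^l.\<close>

lemma XY: "(X s)\<^sup>2 + (Y s)\<^sup>2 = 1"
proof -
  have "((w s) ^ l)\<^sup>2 = (1 - (z s)\<^sup>2) ^ l" by (metis w_sq mult.commute power_mult)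
  also have "\<dots> = (b * sin s * r s)\<^sup>2 + (\<mu> * poly (legendre l) (z s))\<^sup>2"
    using factor[of "z s"] by (simp add: power_mult_distrib r_sq z_sin_sq)
  finally have "((b * sin s * r s)\<^sup>2 + (\<mu> * poly (legendre l) (z s))\<^sup>2) / ((w s) ^ l)\<^sup>2 = 1"
    using w_pos[of s] by (metis divide_self less_irrefl power_not_zero)
  then show ?thesis by (simp add: X_def Y_def power_divide add_divide_distrib)
qed

lemma DERIV_z: "(z has_real_derivative - (b * sin s)) (at s)"
  unfolding z_def[abs_def] by (auto intro!: derivative_eq_intros)

lemma DERIV_w: "(w has_real_derivative z s * (b * sin s) / w s) (at s)"
proof -
  have "((\<lambda>s. 1 - (z s)\<^sup>2) has_real_derivative 2 * (z s * (b * sin s))) (at s)"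
    by (auto intro!: derivative_eq_intros DERIV_z)
  from DERIV_real_sqrt[THEN DERIV_chain2, OF _ this]
  show ?thesis using z_sq[of s] by (simp add: w_def[abs_def] field_simps)
qed

lemma DERIV_r: "(r has_real_derivative - (poly (pderiv R) (z s) * (b * sin s)) / (2 * r s)) (at s)"
proof -
  have "((\<lambda>s. poly R (z s)) has_real_derivative poly (pderiv R) (z s) * - (b * sin s)) (at s)"
    by (rule DERIV_chain2[OF poly_DERIV DERIV_z])
  from DERIV_real_sqrt[THEN DERIV_chain2, OF _ this]
  show ?thesis using R_pos[OF abs_z[of s]] by (simp add: r_def[abs_def] field_simps)
qed

text \<open>Up to the factor (1 - t^2)^(l+1), both sides are the derivative of the two forms of
  \<open>factor\<close> divided by (1 - t^2)^l. The polynomial form supplies the numerator of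
  X'.\<close>

lemma factor_deriv:
  "(1 - t\<^sup>2) * ((b\<^sup>2 - t\<^sup>2) * poly (pderiv R) t - 2 * t * poly R t) + 2 * real l * t * ((b\<^sup>2 - t\<^sup>2) * poly R t)
    = - 2 * \<mu>\<^sup>2 * real l * poly (legendre l) t * poly (legendre (l - 1)) t"
proof -
  let ?P = "poly (legendre l) t" and ?P' = "poly (pderiv (legendre l)) t"
  have "((\<lambda>t. (b\<^sup>2 - t\<^sup>2) * poly R t) has_real_derivative
      (b\<^sup>2 - t\<^sup>2) * poly (pderiv R) t - 2 * t * poly R t) (at t)"
    by (auto intro!: derivative_eq_intros)
  moreover have "((\<lambda>t. (1 - t\<^sup>2) ^ l - \<mu>\<^sup>2 * (poly (legendre l) t)\<^sup>2) has_real_derivative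
      real l * (1 - t\<^sup>2) ^ (l - 1) * (- 2 * t) - \<mu>\<^sup>2 * (2 * ?P * ?P')) (at t)"
    by (auto intro!: derivative_eq_intros)
  ultimately have eq: "(b\<^sup>2 - t\<^sup>2) * poly (pderiv R) t - 2 * t * poly R t =
      real l * (1 - t\<^sup>2) ^ (l - 1) * (- 2 * t) - \<mu>\<^sup>2 * (2 * ?P * ?P')"
    unfolding factor by (rule DERIV_unique)
  have "(1 - t\<^sup>2) * (real l * (1 - t\<^sup>2) ^ (l - 1) * (- 2 * t) - \<mu>\<^sup>2 * (2 * ?P * ?P')) =
      - 2 * real l * t * ((1 - t\<^sup>2) * (1 - t\<^sup>2) ^ (l - 1)) - 2 * \<mu>\<^sup>2 * ?P * ((1 - t\<^sup>2) * ?P')"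
    by (simp only: algebra_simps)
  also have "(1 - t\<^sup>2) * (1 - t\<^sup>2) ^ (l - 1) = (1 - t\<^sup>2) ^ l" using l_pos by (simp add: power_eq_if)
  finally show ?thesis
    unfolding eq factor[symmetric] legendre_deriv[OF l_pos]
    by (simp only:) (simp add: algebra_simps power2_eq_square)
qed

text \<open>omega is defined so that this holds: dY/dz contains P_(l-1) by
  \<open>legendre_deriv\<close>, and dz/ds = - b sin s supplies the factor of X.\<close>

lemma DERIV_Y: "(Y has_real_derivative real l * omega s * X s) (at s)"
proof -
  let ?P = "poly (legendre l) (z s)" and ?P' = "poly (pderiv (legendre l)) (z s)"
  have w: "w s > 0" by (rule w_pos)
  have wl: "w s ^ l = w s * w s ^ (l - 1)" using l_pos by (simp add: power_eq_if)
  have "(Y has_real_derivative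
      ((- \<mu> * (?P' * - (b * sin s))) * w s ^ l
        - (- \<mu> * ?P) * (real l * w s ^ (l - 1) * (z s * (b * sin s) / w s))) / (w s ^ l * w s ^ l)) (at s)"
    unfolding Y_def[abs_def] using w
    by (auto intro!: derivative_eq_intros DERIV_z DERIV_w simp: field_simps)
  also have "((- \<mu> * (?P' * - (b * sin s))) * w s ^ l
        - (- \<mu> * ?P) * (real l * w s ^ (l - 1) * (z s * (b * sin s) / w s))) / (w s ^ l * w s ^ l)
      = \<mu> * (b * sin s) * ((w s)\<^sup>2 * ?P' + real l * z s * ?P) / ((w s)\<^sup>2 * w s ^ l)"
    using w by (simp add: wl field_simps power2_eq_square)
  also have "(w s)\<^sup>2 * ?P' + real l * z s * ?P = real l * poly (legendre (l - 1)) (z s)"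
    unfolding w_sq legendre_deriv[OF l_pos] by (simp add: algebra_simps)
  also have "\<mu> * (b * sin s) * (real l * poly (legendre (l - 1)) (z s)) / ((w s)\<^sup>2 * w s ^ l)
      = real l * omega s * X s"
    using w r_pos[of s] by (simp add: omega_def X_def field_simps)
  finally show ?thesis .
qed

text \<open>Differentiating X^2 + Y^2 = 1 would give this only where X is not 0, hence not where sin
  s = 0. The direct computation with \<open>factor_deriv\<close> covers every s.\<close>

lemma DERIV_X: "(X has_real_derivative - (real l * omega s * Y s)) (at s)"
proof -
  let ?P = "poly (legendre l) (z s)" and ?P1 = "poly (legendre (l - 1)) (z s)"
    and ?R = "poly R (z s)" and ?R' = "poly (pderiv R) (z s)" and ?q = "b * sin s"
  have w: "w s > 0" and r: "r s > 0" by (rule w_pos r_pos)+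
  have wl: "w s ^ l = w s * w s ^ (l - 1)" using l_pos by (simp add: power_eq_if)
  have zc: "b * cos s = z s" by (simp add: z_def)
  have "(X has_real_derivative
      (((b * cos s) * r s + (- (?R' * ?q) / (2 * r s)) * ?q) * w s ^ l
        - (?q * r s) * (real l * w s ^ (l - 1) * (z s * ?q / w s))) / (w s ^ l * w s ^ l)) (at s)"
    unfolding X_def[abs_def] using w
    by (auto intro!: derivative_eq_intros DERIV_r DERIV_w simp: field_simps)
  also have "(((b * cos s) * r s + (- (?R' * ?q) / (2 * r s)) * ?q) * w s ^ l
        - (?q * r s) * (real l * w s ^ (l - 1) * (z s * ?q / w s))) / (w s ^ l * w s ^ l)
      = (2 * z s * (r s)\<^sup>2 * (w s)\<^sup>2 - ?R' * ?q\<^sup>2 * (w s)\<^sup>2 - 2 * real l * z s * ?q\<^sup>2 * (r s)\<^sup>2)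
        / (2 * r s * (w s)\<^sup>2 * w s ^ l)"
    unfolding zc using w r by (simp add: wl field_simps power2_eq_square)
  also have "2 * z s * (r s)\<^sup>2 * (w s)\<^sup>2 - ?R' * ?q\<^sup>2 * (w s)\<^sup>2 - 2 * real l * z s * ?q\<^sup>2 * (r s)\<^sup>2
      = 2 * \<mu>\<^sup>2 * real l * ?P * ?P1"
    using factor_deriv[of "z s"] unfolding z_sin_sq w_sq[symmetric] r_sq by (simp add: algebra_simps)
  also have "2 * \<mu>\<^sup>2 * real l * ?P * ?P1 / (2 * r s * (w s)\<^sup>2 * w s ^ l) = - (real l * omega s * Y s)"
    using w r by (simp add: omega_def Y_def field_simps power2_eq_square)
  finally show ?thesis .
qed

lemma continuous_omega: "isCont omega s"
proof -
  have "isCont z s" "isCont w s" "isCont r s"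
    using DERIV_z DERIV_w DERIV_r DERIV_isCont by blast+
  then show ?thesis unfolding omega_def[abs_def]
    using w_pos[of s] r_pos[of s] by (intro continuous_intros isCont_o2[OF _ poly_isCont]) auto
qed

text \<open>For an antiderivative phi of omega, both (X, Y) and (cos (l phi), sin (l phi)) rotate
  with angular speed l omega. Their inner product e is therefore constant, and it is 1 at s = 0 by
  the choice of phi 0; unit vectors with inner product 1 coincide.\<close>

lemma phase_exists: "\<exists>\<phi>. \<forall>s. (\<phi> has_real_derivative omega s) (at s)
    \<and> cos (real l * \<phi> s) = X s \<and> sin (real l * \<phi> s) = Y s"
proof -
  obtain \<psi> where "\<And>s. (\<psi> has_vector_derivative omega s) (at s)"
    using einterval_antiderivative[of "-\<infinity>" \<infinity> omega] continuous_omega by auto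
  then have psi: "\<And>s. (\<psi> has_real_derivative omega s) (at s)"
    by (simp add: has_real_derivative_iff_has_vector_derivative)
  obtain \<alpha> where \<alpha>: "X 0 = cos \<alpha>" "Y 0 = sin \<alpha>" using sincos_total_2pi[OF XY[of 0]] by metis
  define \<phi> where "\<phi> s = \<psi> s - \<psi> 0 + \<alpha> / real l" for s
  have phi: "(\<phi> has_real_derivative omega s) (at s)" for s
    unfolding \<phi>_def[abs_def] by (auto intro!: derivative_eq_intros psi)
  have phi0: "real l * \<phi> 0 = \<alpha>" using l_pos by (simp add: \<phi>_def)
  define e where "e s = X s * cos (real l * \<phi> s) + Y s * sin (real l * \<phi> s)" for s
  have "(e has_real_derivative 0) (at s)" for s
    unfolding e_def[abs_def]
    by (auto intro!: derivative_eq_intros DERIV_X DERIV_Y phi simp: algebra_simps)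
  then have "e s = e 0" for s using DERIV_isconst_all by metis
  also have "e 0 = 1" by (simp add: e_def phi0 \<alpha> flip: power2_eq_square)
  finally have e1: "e s = 1" for s .
  have "(X s - cos (real l * \<phi> s))\<^sup>2 + (Y s - sin (real l * \<phi> s))\<^sup>2 = 0" for s
  proof -
    have "(X s - cos (real l * \<phi> s))\<^sup>2 + (Y s - sin (real l * \<phi> s))\<^sup>2
        = ((X s)\<^sup>2 + (Y s)\<^sup>2) + ((sin (real l * \<phi> s))\<^sup>2 + (cos (real l * \<phi> s))\<^sup>2) - 2 * e s"
      by (simp only: e_def power2_diff) (simp add: algebra_simps)
    then show ?thesis by (simp only: XY e1 sin_cos_squared_add)
  qed
  then have "cos (real l * \<phi> s) = X s \<and> sin (real l * \<phi> s) = Y s" for s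
    by (simp add: sum_power2_eq_zero_iff)
  with phi show ?thesis by blast
qed

definition phase :: "real \<Rightarrow> real" where
  "phase = (SOME \<phi>. \<forall>s. (\<phi> has_real_derivative omega s) (at s)
    \<and> cos (real l * \<phi> s) = X s \<and> sin (real l * \<phi> s) = Y s)"

lemma DERIV_phase: "(phase has_real_derivative omega s) (at s)"
  and cos_phase: "cos (real l * phase s) = X s"
  and sin_phase: "sin (real l * phase s) = Y s"
  using someI_ex[OF phase_exists] unfolding phase_def by blast+

section \<open>Rotated copies of the nodal curve as smooth immersions\<close>

definition curve :: "real \<Rightarrow> real \<Rightarrow> real^3" where
  "curve \<alpha> s = vector [w s * cos (phase s + \<alpha>), w s * sin (phase s + \<alpha>), z s]"

lemma H_harm_curve:
  assumes "real l * \<alpha> = 2 * pi * of_int j"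
  shows "H_harm \<mu> l (curve \<alpha> s) = 0"
proof -
  have "Complex (w s * cos (phase s + \<alpha>)) (w s * sin (phase s + \<alpha>)) = rcis (w s) (phase s + \<alpha>)"
    by (simp add: complex_eq_iff)
  then have "W_harm l (curve \<alpha> s) = w s ^ l * sin (real l * phase s + 2 * pi * of_int j)"
    using assms by (simp add: W_harm_def curve_def DeMoivre2 distrib_left mult.commute)
  also have "sin (real l * phase s + 2 * pi * of_int j) = Y s"
    by (simp only: sin_add sin_phase sin_int_2pin cos_int_2pin mult_1_right mult_zero_right add_0_right)
  finally show ?thesis
    using w_pos[of s] by (simp add: H_harm_def Z_harm_def curve_def Y_def)
qed

lemma curve_in_S2: "curve \<alpha> s \<in> S2"
proof -
  have "(w s * cos (phase s + \<alpha>))\<^sup>2 + (w s * sin (phase s + \<alpha>))\<^sup>2 + (z s)\<^sup>2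
      = (w s)\<^sup>2 * ((sin (phase s + \<alpha>))\<^sup>2 + (cos (phase s + \<alpha>))\<^sup>2) + (z s)\<^sup>2"
    by (simp only: power_mult_distrib distrib_left add.commute)
  also have "\<dots> = 1" by (simp only: sin_cos_squared_add w_sq) simp
  finally show ?thesis by (simp add: curve_def norm_vec_def L2_set_def sum_3)
qed

text \<open>The height is stationary only where sin s = 0, that is where z is b or -b. There w is
  stationary too, and the velocity has length w |omega| along the parallel, which is not 0 because
  P_(l-1) does not vanish at b and -b.\<close>

lemma regular_curve: "regular_curve_on UNIV (curve \<alpha>)"
proof -
  define wi where "wi s = 1 / w s" for s
  define ri where "ri s = 1 / r s" for s
  define co where "co s = cos (phase s + \<alpha>)" for s
  define si where "si s = sin (phase s + \<alpha>)" for s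
  \<comment> \<open>The algebra has no division, so the reciprocals of w and r are generators of
    their own. The phase enters only through its cosine and sine, shifted by alpha, and through its
    derivative omega.\<close>
  define G where "G = {sin, cos, w, wi, r, ri, co, si}"
  let ?A = "gen_algebra G"
  have gens: "sin \<in> ?A" "cos \<in> ?A" "w \<in> ?A" "wi \<in> ?A" "r \<in> ?A" "ri \<in> ?A" "co \<in> ?A" "si \<in> ?A"
    by (auto simp: G_def intro: gen_algebra.gen)
  note closure = gen_algebra.const gen_algebra.add gen_algebra.mult gen_algebra_minus
  have z: "z \<in> ?A" unfolding z_def[abs_def] by (intro closure gens)
  have q: "(\<lambda>s. b * sin s) \<in> ?A" by (intro closure gens)
  have "omega = (\<lambda>s. \<mu> * poly (legendre (l - 1)) (z s) * (wi s * wi s * ri s))"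
    by (simp add: omega_def[abs_def] wi_def ri_def power2_eq_square)
  then have omega: "omega \<in> ?A" by (simp only:) (intro closure gens gen_algebra_poly z)
  have w': "(\<lambda>s. z s * (b * sin s) * wi s) \<in> ?A" by (intro closure gens z q)
  have r': "(\<lambda>s. - (poly (pderiv R) (z s) * (b * sin s)) * (1 / 2 * ri s)) \<in> ?A"
    by (intro closure gens gen_algebra_poly z q)
  have D_w: "(w has_real_derivative z s * (b * sin s) * wi s) (at s)" for s
    using DERIV_w[of s] by (simp add: wi_def)
  have D_r: "(r has_real_derivative - (poly (pderiv R) (z s) * (b * sin s)) * (1 / 2 * ri s)) (at s)" for s
    using DERIV_r[of s] by (simp add: ri_def)
  have D_wi: "(wi has_real_derivative - (z s * (b * sin s) * wi s * (wi s * wi s))) (at s)" for s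
    unfolding wi_def[abs_def] using w_pos[of s]
    by (auto intro!: derivative_eq_intros D_w simp: wi_def)
  have D_ri: "(ri has_real_derivative
      - (- (poly (pderiv R) (z s) * (b * sin s)) * (1 / 2 * ri s) * (ri s * ri s))) (at s)" for s
    unfolding ri_def[abs_def] using r_pos[of s]
    by (auto intro!: derivative_eq_intros D_r simp: ri_def)
  have D_co: "(co has_real_derivative - (si s * omega s)) (at s)"
    and D_si: "(si has_real_derivative co s * omega s) (at s)" for s
    unfolding co_def[abs_def] si_def[abs_def] by (auto intro!: derivative_eq_intros DERIV_phase)
  have closed: "deriv_closed ?A"
  proof (rule deriv_closed_gen_algebra)
    fix g assume "g \<in> G"
    then consider "g = sin" | "g = cos" | "g = w" | "g = wi" | "g = r" | "g = ri" | "g = co" | "g = si"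
      by (auto simp: G_def)
    then show "\<exists>g'\<in>?A. \<forall>s. (g has_real_derivative g' s) (at s)"
    proof cases
      case 1
      then show ?thesis by (auto intro!: bexI[of _ cos] gens derivative_eq_intros)
    next
      case 2
      then show ?thesis by (auto intro!: bexI[of _ "\<lambda>s. - sin s"] gen_algebra_minus gens derivative_eq_intros)
    next
      case 3
      show ?thesis by (unfold 3, rule bexI[OF _ w'], intro allI D_w)
    next
      case 4
      have "(\<lambda>s. - (z s * (b * sin s) * wi s * (wi s * wi s))) \<in> ?A" by (intro closure w' gens)
      then show ?thesis by (unfold 4, elim bexI[rotated], intro allI D_wi)
    next
      case 5
      show ?thesis by (unfold 5, rule bexI[OF _ r'], intro allI D_r)
    next
      case 6
      have "(\<lambda>s. - (- (poly (pderiv R) (z s) * (b * sin s)) * (1 / 2 * ri s) * (ri s * ri s))) \<in> ?A"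
        by (intro gen_algebra_minus[of "\<lambda>s. - (poly (pderiv R) (z s) * (b * sin s)) * (1 / 2 * ri s) * (ri s * ri s)"]
            gen_algebra.mult[OF r'] gen_algebra.mult gens)
      then show ?thesis by (unfold 6, elim bexI[rotated], intro allI D_ri)
    next
      case 7
      have "(\<lambda>s. - (si s * omega s)) \<in> ?A" by (intro closure omega gens)
      then show ?thesis by (unfold 7, elim bexI[rotated], intro allI D_co)
    next
      case 8
      have "(\<lambda>s. co s * omega s) \<in> ?A" by (intro closure omega gens)
      then show ?thesis by (unfold 8, elim bexI[rotated], intro allI D_si)
    qed
  qed
  have curve_eq: "curve \<alpha> = (\<lambda>s. vector [w s * co s, w s * si s, z s])"
    by (simp add: curve_def[abs_def] co_def si_def)
  have "smooth_curve_on UNIV (curve \<alpha>)"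
    unfolding curve_eq by (intro smooth_curve_on_deriv_closed[OF closed] gen_algebra.mult gens z)
  moreover have "vector_derivative (curve \<alpha>) (at s) \<noteq> 0" for s
  proof
    assume 0: "vector_derivative (curve \<alpha>) (at s) = 0"
    let ?w' = "z s * (b * sin s) * wi s"
    have "(curve \<alpha> has_vector_derivative vector [?w' * co s + - (si s * omega s) * w s,
        ?w' * si s + co s * omega s * w s, - (b * sin s)]) (at s)"
      unfolding curve_eq
      by (intro has_vector_derivative_vector_3 DERIV_mult D_w D_co D_si DERIV_z)
    from vector_derivative_at[OF this] 0
    have "vector [?w' * co s + - (si s * omega s) * w s, ?w' * si s + co s * omega s * w s, - (b * sin s)]
        = (0 :: real^3)" by simp
    then have "?w' * co s + - (si s * omega s) * w s = 0" "?w' * si s + co s * omega s * w s = 0"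
      and "b * sin s = 0"
      by (simp_all add: vec_eq_iff forall_3)
    then have sin0: "sin s = 0" and so: "si s * omega s = 0" "co s * omega s = 0"
      using b_pos w_pos[of s] by auto
    have "(si s)\<^sup>2 + (co s)\<^sup>2 = 1" by (simp add: si_def co_def)
    then have "omega s = 0" using so by (cases "omega s = 0") auto
    then have P0: "poly (legendre (l - 1)) (z s) = 0"
      using mu_pos w_pos[of s] r_pos[of s] by (simp add: omega_def)
    have "\<bar>cos s\<bar> = 1" using sin0 by (rule sin_zero_abs_cos_one)
    then have "z s = b \<or> z s = - b" by (auto simp: z_def abs_if split: if_splits)
    with P0 legendre_b show False by (auto simp: legendre_minus_eq_0_iff)
  qed
  ultimately show ?thesis unfolding regular_curve_on_def by blast
qed

section \<open>Periodicity, the shift k and coincidences between curves\<close>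

lemma periodic:
  fixes m :: int
  shows "z (s + 2 * pi * m) = z s" "w (s + 2 * pi * m) = w s" "omega (s + 2 * pi * m) = omega s"
    "X (s + 2 * pi * m) = X s" "Y (s + 2 * pi * m) = Y s"
proof -
  have sc: "sin (s + 2 * pi * m) = sin s" "cos (s + 2 * pi * m) = cos s"
    by (simp_all only: sin_add cos_add sin_int_2pin cos_int_2pin mult_1_right mult_zero_right add_0_right diff_zero)
  show "z (s + 2 * pi * m) = z s" by (simp only: z_def sc)
  then show "w (s + 2 * pi * m) = w s" "omega (s + 2 * pi * m) = omega s"
    "X (s + 2 * pi * m) = X s" "Y (s + 2 * pi * m) = Y s"
    by (simp_all only: w_def r_def omega_def X_def Y_def sc)
qed

text \<open>X and Y, the cosine and sine of l times the phase, have period 2 pi, so from 0 to 2 pi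
  this angle grows by some 2 pi k. As omega is periodic too, the growth over one period is the same
  from every s.\<close>

lemma phase_shift:
  obtains k :: int where
    "\<And>s m. phase (s + 2 * pi * of_int m) = phase s + 2 * pi * of_int (k * m) / real l"
proof -
  have "sin (real l * phase (0 + 2 * pi * of_int 1)) = sin (real l * phase 0)
      \<and> cos (real l * phase (0 + 2 * pi * of_int 1)) = cos (real l * phase 0)"
    by (simp only: cos_phase sin_phase periodic)
  then obtain k where "real l * phase (0 + 2 * pi * of_int 1) = real l * phase 0 + 2 * pi * of_int k"
    unfolding sin_cos_eq_iff by blast
  then have k: "phase (2 * pi) = phase 0 + 2 * pi * of_int k / real l"
    using l_pos by (simp add: field_simps)
  have "((\<lambda>s. phase (s + 2 * pi) - phase s) has_real_derivative 0) (at s)" for s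
  proof -
    have "((\<lambda>s. phase (s + 2 * pi)) has_real_derivative omega (s + 2 * pi)) (at s)"
      using DERIV_shift[of phase] DERIV_phase by blast
    from DERIV_diff[OF this DERIV_phase] show ?thesis using periodic(3)[of s 1] by simp
  qed
  then have "phase (s + 2 * pi) - phase s = phase (0 + 2 * pi) - phase 0" for s
    using DERIV_isconst_all[of "\<lambda>s. phase (s + 2 * pi) - phase s" s 0] by blast
  then have step: "phase (s + 2 * pi) = phase s + 2 * pi * of_int k / real l" for s
    using k by (simp add: algebra_simps)
  have nat: "phase (s + 2 * pi * real n) = phase s + 2 * pi * of_int k * real n / real l" for s n
  proof (induction n)
    case (Suc n)
    then show ?case using step[of "s + 2 * pi * real n"] by (simp add: algebra_simps add_divide_distrib)
  qed simp
  have "phase (s + 2 * pi * of_int m) = phase s + 2 * pi * of_int (k * m) / real l" for s m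
  proof (cases m rule: int_cases2)
    case (nonneg n)
    then show ?thesis using nat[of s n] by (simp add: mult.assoc)
  next
    case (nonpos n)
    \<comment> \<open>For m = -n the rule for n is applied at s + 2 pi m.\<close>
    then show ?thesis using nat[of "s + 2 * pi * of_int m" n] by (simp add: algebra_simps)
  qed
  then show ?thesis by (rule that)
qed

text \<open>The heights determine cos s, the horizontal coordinates the longitude modulo 2 pi. For
  sin s, X is used: both rotation angles are multiples of 2 pi / l, so l times the phase agrees
  modulo 2 pi at s and t, hence X s = X t and sin s = sin t.\<close>

lemma curve_eqD:
  assumes "curve \<alpha> s = curve \<beta> t" "real l * \<alpha> = 2 * pi * of_int i" "real l * \<beta> = 2 * pi * of_int j"
  obtains m a :: int where "t = s + 2 * pi * of_int m" "phase t + \<beta> = phase s + \<alpha> + 2 * pi * of_int a"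
proof -
  from assms(1) have eqs: "w s * cos (phase s + \<alpha>) = w t * cos (phase t + \<beta>)"
    "w s * sin (phase s + \<alpha>) = w t * sin (phase t + \<beta>)" "z s = z t"
    by (simp_all add: curve_def vec_eq_iff forall_3)
  then have "w s = w t" "r s = r t" by (simp_all add: w_def r_def)
  then obtain a where a: "phase t + \<beta> = phase s + \<alpha> + 2 * pi * of_int a"
    using eqs(1,2) w_pos[of s] sin_cos_eq_iff[of "phase t + \<beta>" "phase s + \<alpha>"] by auto
  then have "real l * (phase t + \<beta>) = real l * (phase s + \<alpha> + 2 * pi * of_int a)" by simp
  then have "real l * phase t = real l * phase s + 2 * pi * of_int (i - j + int l * a)"
    using assms(2,3) by (simp add: algebra_simps)
  then have "cos (real l * phase t) = cos (real l * phase s)"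
    using sin_cos_eq_iff by metis
  then have "X t = X s" by (simp only: cos_phase)
  then have "sin t = sin s"
    using \<open>w s = w t\<close> \<open>r s = r t\<close> b_pos w_pos[of t] r_pos[of t] by (simp add: X_def)
  moreover have "cos t = cos s" using eqs(3) b_pos by (simp add: z_def)
  ultimately obtain m where "t = s + 2 * pi * of_int m" using sin_cos_eq_iff[of t s] by auto
  from this a show ?thesis by (rule that)
qed

text \<open>The nodal equation forces |t| <= b, so t = b cos s has the solutions s0 and -s0. The one
  whose sine has the sign of cos (l psi) gives X as well as Y the right value; then longitude and
  phase differ by a multiple of 2 pi / l.\<close>

lemma nodal_point_on_curve:
  assumes "p \<in> nodal_set (H_harm \<mu> l)"
  obtains s and j :: int where "p = curve (2 * pi * of_int j / real l) s"
proof -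
  from assms have "p \<in> S2" and H0: "H_harm \<mu> l p = 0" by (auto simp: nodal_set_def)
  then obtain \<theta> \<psi> where p: "p = spherical_coords \<theta> \<psi>" and th: "0 \<le> \<theta>" "\<theta> \<le> pi"
    unfolding spherical_coords_image[symmetric] by auto
  define t where "t = cos \<theta>"
  let ?P = "poly (legendre l) t"
  have sin_nonneg: "sin \<theta> \<ge> 0" using th by (simp add: sin_ge_zero)
  have H: "sin \<theta> ^ l * sin (real l * \<psi>) = - \<mu> * ?P"
    using H0 by (simp add: p H_harm_spherical_coords t_def)
  have pw: "(sin \<theta> ^ l)\<^sup>2 = (1 - t\<^sup>2) ^ l"
    unfolding t_def by (metis mult.commute power_mult sin_squared_eq)
  have "\<mu>\<^sup>2 * ?P\<^sup>2 = (sin \<theta> ^ l * sin (real l * \<psi>))\<^sup>2" by (simp add: H power_mult_distrib)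
  also have "\<dots> \<le> (1 - t\<^sup>2) ^ l"
    unfolding power_mult_distrib pw
    by (intro mult_left_le) (auto simp: abs_square_le_1 t_def abs_cos_le_one)
  finally have "\<bar>t\<bar> \<le> b" using outside[of t] by (force simp: t_def)
  then have tb: "- 1 \<le> t / b" "t / b \<le> 1" using b_pos by (auto simp: field_simps abs_le_iff)
  define s0 where "s0 = arccos (t / b)"
  define s where "s = (if cos (real l * \<psi>) \<ge> 0 then s0 else - s0)"
  have "cos s0 = t / b" "sin s0 \<ge> 0"
    using tb arccos_lbound[OF tb] arccos_ubound[OF tb]
    by (auto simp: s0_def cos_arccos intro!: sin_ge_zero)
  then have z: "z s = t" and sgn: "cos (real l * \<psi>) \<ge> 0 \<Longrightarrow> sin s \<ge> 0" "cos (real l * \<psi>) < 0 \<Longrightarrow> sin s \<le> 0"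
    using b_pos by (auto simp: z_def s_def)
  have w: "w s = sin \<theta>" using sin_nonneg by (simp add: w_def z t_def flip: sin_squared_eq)
  have Y: "Y s = sin (real l * \<psi>)" using H w_pos[of s] by (simp add: Y_def z w field_simps)
  have "(X s)\<^sup>2 = (cos (real l * \<psi>))\<^sup>2" using XY[of s] by (simp add: Y cos_squared_eq)
  then have "\<bar>X s\<bar> = \<bar>cos (real l * \<psi>)\<bar>" by (simp add: power2_eq_iff abs_eq_iff)
  moreover have "sin s \<ge> 0 \<Longrightarrow> X s \<ge> 0" "sin s \<le> 0 \<Longrightarrow> X s \<le> 0"
    using b_pos w_pos[of s] r_pos[of s]
    by (auto simp: X_def mult_nonneg_nonpos mult_nonneg_nonpos2 divide_nonpos_pos)
  ultimately have X: "X s = cos (real l * \<psi>)" using sgn by (cases "cos (real l * \<psi>) \<ge> 0") auto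
  obtain j where "real l * \<psi> = real l * phase s + 2 * pi * of_int j"
    using X Y sin_cos_eq_iff[of "real l * \<psi>" "real l * phase s"] by (auto simp: cos_phase sin_phase)
  then have "\<psi> = phase s + 2 * pi * of_int j / real l" using l_pos by (simp add: field_simps)
  then have "p = curve (2 * pi * of_int j / real l) s"
    by (simp add: p curve_def spherical_coords_def w z t_def)
  then show ?thesis by (rule that)
qed

text \<open>The copies are the rotations by 2 pi j / l. For t = s + 2 pi m, equality of longitudes
  modulo 2 pi becomes, after multiplication by l / (2 pi), the congruence i = j + k m modulo
  l.\<close>

lemma nodal_set_cyclic_curves:
  "\<exists>C k. cyclic_curves C (int l) k \<and> nodal_set (H_harm \<mu> l) = (\<Union>j. range (C j))"
proof -
  obtain k where k: "\<And>s m. phase (s + 2 * pi * of_int m) = phase s + 2 * pi * of_int (k * m) / real l"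
    using phase_shift by blast
  define C where "C j = curve (2 * pi * of_int j / real l)" for j :: int
  have l: "real l > 0" using l_pos by simp
  have la: "real l * (2 * pi * of_int j / real l) = 2 * pi * of_int j" for j :: int using l by simp
  have "cyclic_curves C (int l) k"
  proof
    show "int l > 0" using l_pos by simp
    show "regular_curve_on UNIV (C j)" for j unfolding C_def by (rule regular_curve)
    show "C i s = C j t \<longleftrightarrow> (\<exists>m. t = s + 2 * pi * of_int m \<and> int l dvd i - j - k * m)" for i j s t
    proof
      assume eq: "C i s = C j t"
      obtain m a where t: "t = s + 2 * pi * of_int m"
        and a: "phase t + 2 * pi * of_int j / real l = phase s + 2 * pi * of_int i / real l + 2 * pi * of_int a"
        by (rule curve_eqD[OF eq[unfolded C_def] la la])
      from a have "2 * pi * of_int (k * m + j) = 2 * pi * (of_int i + real l * of_int a)"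
        unfolding t k using l by (simp add: field_simps)
      then have "real_of_int (k * m + j) = real_of_int (i + int l * a)" by simp
      then have "k * m + j = i + int l * a" by (simp only: of_int_eq_iff)
      then have "i - j - k * m = int l * (- a)" by (simp add: algebra_simps)
      with t show "\<exists>m. t = s + 2 * pi * of_int m \<and> int l dvd i - j - k * m" by (metis dvd_triv_left)
    next
      assume "\<exists>m. t = s + 2 * pi * of_int m \<and> int l dvd i - j - k * m"
      then obtain m where t: "t = s + 2 * pi * of_int m" and "int l dvd i - j - k * m" by blast
      then obtain a where "i - j - k * m = int l * a" by (elim dvdE)
      then have "i = k * m + j + int l * a" by simp
      then have "phase s + 2 * pi * of_int i / real l
          = (phase t + 2 * pi * of_int j / real l) + 2 * pi * of_int a"
        unfolding t k using l by (simp add: field_simps)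
      then have "sin (phase s + 2 * pi * of_int i / real l) = sin (phase t + 2 * pi * of_int j / real l)
        \<and> cos (phase s + 2 * pi * of_int i / real l) = cos (phase t + 2 * pi * of_int j / real l)"
        unfolding sin_cos_eq_iff by blast
      then show "C i s = C j t" by (simp add: C_def curve_def t periodic)
    qed
  qed
  moreover have "nodal_set (H_harm \<mu> l) = (\<Union>j. range (C j))"
  proof (intro equalityI subsetI)
    fix p assume "p \<in> nodal_set (H_harm \<mu> l)"
    then obtain s j where "p = curve (2 * pi * of_int j / real l) s" by (rule nodal_point_on_curve)
    then show "p \<in> (\<Union>j. range (C j))" by (auto simp: C_def)
  next
    fix p assume "p \<in> (\<Union>j. range (C j))"
    then obtain j s where "p = C j s" by blast
    then show "p \<in> nodal_set (H_harm \<mu> l)"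
      using curve_in_S2 H_harm_curve[OF la] unfolding nodal_set_def C_def by blast
  qed
  ultimately show ?thesis by blast
qed

end

theorem lemma1:
  fixes l :: nat and \<mu> :: real
  assumes "l \<ge> 1" and "\<mu> > 0"
  shows "H_harm \<mu> l north_pole \<noteq> 0 \<and> H_harm \<mu> l south_pole \<noteq> 0 \<and>
    (\<mu> \<notin> {mu_crit i l |i. 1 \<le> i \<and> i \<le> l div 2} \<longrightarrow> (\<nexists>p. critical_zero (H_harm \<mu> l) p)) \<and>
    mu_c l > 0 \<and>
    (ereal \<mu> < mu_c l \<longrightarrow>
       (\<nexists>p. critical_zero (H_harm \<mu> l) p) \<and>
       one_dim_submanifold_of_S2 (nodal_set (H_harm \<mu> l)) \<and>
       (\<exists>\<C>. finite \<C> \<and> disjoint \<C> \<and> (\<forall>C\<in>\<C>. regular_simple_closed_curve C) \<and>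
            \<Union>\<C> = nodal_set (H_harm \<mu> l)))"
proof (intro conjI impI)
  show "\<nexists>p. critical_zero (H_harm \<mu> l) p" if "\<mu> \<notin> {mu_crit i l |i. 1 \<le> i \<and> i \<le> l div 2}"
    using critical_zero_H_harm[OF assms] that by blast
  show "\<nexists>p. critical_zero (H_harm \<mu> l) p" if "ereal \<mu> < mu_c l"
    using critical_zero_H_harm[OF assms] less_mu_c_notin[OF that] by blast
  assume mu: "ereal \<mu> < mu_c l"
  from assms mu obtain b R where "nodal_curve l \<mu> b R" by (rule nodal_band)
  from nodal_curve.nodal_set_cyclic_curves[OF this] obtain C k where C: "cyclic_curves C (int l) k"
    and N: "nodal_set (H_harm \<mu> l) = (\<Union>j. range (C j))" by blast
  have "(\<Union>j. range (C j)) \<subseteq> S2" unfolding N[symmetric] nodal_set_def by blast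
  then show "one_dim_submanifold_of_S2 (nodal_set (H_harm \<mu> l))"
    unfolding N by (rule cyclic_curves.one_dim_submanifold_union[OF C])
  show "\<exists>\<C>. finite \<C> \<and> disjoint \<C> \<and> (\<forall>C\<in>\<C>. regular_simple_closed_curve C) \<and>
      \<Union>\<C> = nodal_set (H_harm \<mu> l)"
  proof (intro exI conjI ballI)
    \<comment> \<open>The components form a set of images, so copies with the same image count
      once.\<close>
    show "finite (range (\<lambda>j. range (C j)))" by (rule cyclic_curves.finite_ranges[OF C])
    show "disjoint (range (\<lambda>j. range (C j)))" by (rule cyclic_curves.disjoint_ranges[OF C])
    show "regular_simple_closed_curve D" if "D \<in> range (\<lambda>j. range (C j))" for D
      using that cyclic_curves.regular_simple_closed_curve_C[OF C] by blast
  qed (simp add: N)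
qed (use H_harm_poles[OF assms] mu_c_pos in auto)

end
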